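(* Let $\alpha,\beta$ be reals with $1/\sqrt{2}<\alpha<3/4$ and $\mathscr{B}(\alpha)<\beta\leqslant\alpha^2$, where $\mathscr{B}(\alpha)=(\sqrt{1+4\alpha}-1)/2$. Let $\eta=\alpha-1/\sqrt{2}$, and let $\varepsilon=\min\{\beta-\mathscr{B}(\alpha),\alpha^2-\beta\}$ if $\beta<\alpha^2$, and $\varepsilon=1$ if $\beta=\alpha^2$. Let $\mathcal{T}_0,\mathcal{T}_1,\ldots,\mathcal{T}_k$ be $\mathrm{GCB}_{\alpha,\beta}$-trees where $\mathcal{T}_0$ is the empty tree and, for each $\ell\geqslant 0$, $\mathcal{T}_{\ell+1}$ is obtained from $\mathcal{T}_\ell$ by inserting a leaf or deleting a leaf, using either the bottom-up update algorithm or the top-down update algorithm. Then the total number of rotations performed while transforming $\mathcal{T}_0$ into $\mathcal{T}_k$ through these steps is $\mathcal{O}(k/\eta+k/\varepsilon)$ (the implied constant being independent of $\alpha$, $\beta$ and $k$).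
   Context: Weights: the weight $|\mathcal{T}|$ of a binary search tree is its number of empty sub-trees (number of nodes plus one); the weight $|n|$ of a node is the weight of its sub-tree. Each empty tree (weight 1) is viewed as an infinite complete binary tree whose depth-$d$ nodes have weight $2^{-d}$. For a node $n$, its left/right children are $n_1,n_2$, the children of $n_i$ are $n_{i1},n_{i2}$, and so on. $\mathsf{bal_C}(n)=\max\{|n_1|,|n_2|\}/|n|$, $\mathsf{bal_{GC}}(n)=\max_{i,j}|n_{ij}|/|n|$; $n$ is $(x,y)$-balanced if $\mathsf{bal_C}(n)\leqslant x$ and $\mathsf{bal_{GC}}(n)\leqslant y$; a $\mathrm{GCB}_{\alpha,\beta}$-tree is a tree all of whose nodes are $(\alpha,\beta)$-balanced. Let $\mathsf{R}(t)=\min\{-t,t-1\}$, $\hat{\alpha}=\dfrac{1-2\alpha+6\alpha^2-\sqrt{(1-\alpha)(5-\alpha)}}{5(2\alpha-1)}$, $\hat{\beta}=\dfrac{1+\alpha-\sqrt{(1-\alpha)^2+4\alpha(\alpha^2-\beta)}}{2(1-\alpha^2+\beta)}\alpha$. Rotations on a tree with root $n$: the simple rotation makes $n_1$ the root, with children $n_{11}$ and $n$, where $n$ now has children $n_{12}$ and $n_2$; the double rotation makes $n_{12}$ the root, with left child $n_1$ (children $n_{11},n_{121}$) and right child $n$ (children $n_{122},n_2$). Mirror images exchange left and right. $\mathsf{C}(u,v,w,x)$-balancing, on a tree with root $n$: if $|n_1|>u|n|+w$ and $|n_{11}|\geqslant(1-v)|n|-x$, simple rotation; if $|n_2|>u|n|+w$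 and $|n_{22}|\geqslant(1-v)|n|-x$, its mirror; if $|n_1|>u|n|+w$ and $|n_{11}|<(1-v)|n|-x$, double rotation; if $|n_2|>u|n|+w$ and $|n_{22}|<(1-v)|n|-x$, its mirror; otherwise do nothing. $\mathsf{GC}(y,z)$-balancing: if $|n_{11}|>y|n|+z$, simple rotation; if $|n_{22}|>y|n|+z$, its mirror; if $|n_{12}|>y|n|+z$, double rotation; if $|n_{21}|>y|n|+z$, its mirror; otherwise do nothing. $\mathsf{C}\mathsf{GC}(u,v,y,\hat{y})$-balancing, on input $\mathcal{T}$: apply $\mathsf{C}(u,v,0,0)$-balancing, obtaining $\mathcal{T}^{(1)}$; if $\mathcal{T}\neq\mathcal{T}^{(1)}$, apply $\mathsf{GC}(\hat{y},0)$-balancing to the left and right sub-trees of $\mathcal{T}^{(1)}$, then $\mathsf{GC}(\hat{y},0)$-balancing to the resulting whole tree; otherwise apply $\mathsf{GC}(y,0)$-balancing to $\mathcal{T}$. $\mathsf{R}\mathsf{C}\mathsf{GC}(u,v,y,\hat{y})$-balancing, on input $\mathcal{T}$: apply $\mathsf{C}(u,v,\mathsf{R}(u),\mathsf{R}(v))$-balancing, obtaining $\mathcal{T}^{(1)}$; if $\mathcal{T}\neq\mathcal{T}^{(1)}$: apply $\mathsf{C}\mathsf{GC}(v,v,\hat{y},\hat{y})$-balancing to both sub-trees of $\mathcal{T}^{(1)}$, then $\mathsf{GC}(\hat{y},\mathsf{R}(\hat{y}))$-balancing to the whole tree, then $\mathsf{C}\mathsf{GC}(v,v,\hat{y},\hat{y})$-balancing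 to both sub-trees of the result; otherwise apply $\mathsf{GC}(y,\mathsf{R}(y))$-balancing to $\mathcal{T}$ and, if this changed the tree, apply $\mathsf{C}\mathsf{GC}(v,v,\hat{y},\hat{y})$-balancing to both sub-trees of the result. Updates: inserting replaces an empty sub-tree by a new leaf $s$; deleting removes a leaf $s$; a redundant update leaves weights unchanged. A perfectly balanced tree is one where the weights of any two siblings differ by at most $1$. Bottom-up update algorithm on $\mathcal{T}$: if $\mathcal{T}$ has at most $11$ nodes, insert or delete $s$ (if possible) and restructure into a perfectly balanced tree; otherwise recursively update the sub-tree in which $s$ lies, then, if the update is non-redundant, update the root weight and apply $\mathsf{C}\mathsf{GC}(\alpha,\hat{\alpha},\beta,\hat{\beta})$-balancing to $\mathcal{T}$. Top-down update algorithm on $\mathcal{T}$: if $\mathcal{T}$ has at most $29$ nodes, insert or delete $s$ (if possible) and restructure into a perfectly balanced tree; otherwise apply $\mathsf{R}\mathsf{C}\mathsf{GC}(\alpha,\hat{\alpha},\beta,\hat{\beta})$-balancing to $\mathcal{T}$, update the root weight, and recursively update the sub-tree containing $s$. Each restructuring of a tree with at most $29$ nodes into a perfectly balanced tree is counted as a bounded number of rotations. *)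

theory Defs
  imports Complex_Main "HOL-Library.Tree"
begin

section \<open>Weights and balance\<close>

datatype side = Lft | Rgt

text \<open>
  \<open>wt t p\<close> is the weight of the node reached from the root of \<open>t\<close> along the path \<open>p\<close>, so that
  \<open>wt t []\<close>, \<open>wt t [Lft]\<close>, \<open>wt t [Lft, Rgt]\<close> are the weights of $n$, $n_1$, $n_{12}$. Below an empty
  tree the weight is halved at each step: an empty tree stands for an infinite complete binary tree
  whose nodes of depth $d$ have weight $2^{-d}$.
\<close>

fun wt :: "'a tree \<Rightarrow> side list \<Rightarrow> real" where
  "wt t [] = real (size1 t)"
| "wt \<langle>\<rangle> (_ # p) = wt \<langle>\<rangle> p / 2"
| "wt \<langle>l, _, r\<rangle> (Lft # p) = wt l p"
| "wt \<langle>l, _, r\<rangle> (Rgt # p) = wt r p"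

definition bal_C :: "'a tree \<Rightarrow> real" where
  "bal_C t = max (wt t [Lft]) (wt t [Rgt]) / wt t []"

definition bal_GC :: "'a tree \<Rightarrow> real" where
  "bal_GC t = Max {wt t [i, j] |i j. True} / wt t []"

definition balanced_node :: "real \<Rightarrow> real \<Rightarrow> 'a tree \<Rightarrow> bool" where
  "balanced_node x y t \<longleftrightarrow> bal_C t \<le> x \<and> bal_GC t \<le> y"

text \<open>
  \<^const>\<open>subtrees\<close> contains the empty sub-trees as well. The strict descendants of an empty tree
  have the same balances ($1/2$ and $1/4$) as the empty tree itself.
\<close>

definition GCB :: "real \<Rightarrow> real \<Rightarrow> 'a tree \<Rightarrow> bool" where
  "GCB \<alpha> \<beta> t \<longleftrightarrow> (\<forall>s \<in> subtrees t. balanced_node \<alpha> \<beta> s)"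


section \<open>Parameters\<close>

definition offset_R :: "real \<Rightarrow> real" where
  "offset_R t = min (- t) (t - 1)"

definition alpha_hat :: "real \<Rightarrow> real" where
  "alpha_hat \<alpha> =
     (1 - 2 * \<alpha> + 6 * \<alpha>\<^sup>2 - sqrt ((1 - \<alpha>) * (5 - \<alpha>))) / (5 * (2 * \<alpha> - 1))"

definition beta_hat :: "real \<Rightarrow> real \<Rightarrow> real" where
  "beta_hat \<alpha> \<beta> =
     (1 + \<alpha> - sqrt ((1 - \<alpha>)\<^sup>2 + 4 * \<alpha> * (\<alpha>\<^sup>2 - \<beta>))) / (2 * (1 - \<alpha>\<^sup>2 + \<beta>)) * \<alpha>"

definition script_B :: "real \<Rightarrow> real" where
  "script_B \<alpha> = (sqrt (1 + 4 * \<alpha>) - 1) / 2"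

definition eta :: "real \<Rightarrow> real" where
  "eta \<alpha> = \<alpha> - 1 / sqrt 2"

definition eps :: "real \<Rightarrow> real \<Rightarrow> real" where
  "eps \<alpha> \<beta> = (if \<beta> < \<alpha>\<^sup>2 then min (\<beta> - script_B \<alpha>) (\<alpha>\<^sup>2 - \<beta>) else 1)"


section \<open>Rotations\<close>

text \<open>
  The suffix \<open>l\<close> is for the rotations that lift $n_1$ or $n_{12}$, the suffix \<open>r\<close> for their mirror
  images. On a tree where one of the nodes involved is missing, they do nothing.
\<close>

fun simple_l :: "'a tree \<Rightarrow> 'a tree" where
  "simple_l \<langle>\<langle>t11, x1, t12\<rangle>, x, t2\<rangle> = \<langle>t11, x1, \<langle>t12, x, t2\<rangle>\<rangle>"
| "simple_l t = t"

fun simple_r :: "'a tree \<Rightarrow> 'a tree" where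
  "simple_r \<langle>t1, x, \<langle>t21, x2, t22\<rangle>\<rangle> = \<langle>\<langle>t1, x, t21\<rangle>, x2, t22\<rangle>"
| "simple_r t = t"

fun double_l :: "'a tree \<Rightarrow> 'a tree" where
  "double_l \<langle>\<langle>t11, x1, \<langle>t121, x12, t122\<rangle>\<rangle>, x, t2\<rangle> =
     \<langle>\<langle>t11, x1, t121\<rangle>, x12, \<langle>t122, x, t2\<rangle>\<rangle>"
| "double_l t = t"

fun double_r :: "'a tree \<Rightarrow> 'a tree" where
  "double_r \<langle>t1, x, \<langle>\<langle>t211, x21, t212\<rangle>, x2, t22\<rangle>\<rangle> =
     \<langle>\<langle>t1, x, t211\<rangle>, x21, \<langle>t212, x2, t22\<rangle>\<rangle>"
| "double_r t = t"


section \<open>Balancing procedures\<close>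

text \<open>
  Each procedure returns the resulting tree together with the number of (simple or double)
  rotations that it performed.
\<close>

definition C_balance ::
  "real \<Rightarrow> real \<Rightarrow> real \<Rightarrow> real \<Rightarrow> 'a tree \<Rightarrow> 'a tree \<times> nat" where
  "C_balance u v w x t =
    (let n = wt t [] in
     if wt t [Lft] > u * n + w \<and> wt t [Lft, Lft] \<ge> (1 - v) * n - x then (simple_l t, 1)
     else if wt t [Rgt] > u * n + w \<and> wt t [Rgt, Rgt] \<ge> (1 - v) * n - x then (simple_r t, 1)
     else if wt t [Lft] > u * n + w \<and> wt t [Lft, Lft] < (1 - v) * n - x then (double_l t, 1)
     else if wt t [Rgt] > u * n + w \<and> wt t [Rgt, Rgt] < (1 - v) * n - x then (double_r t, 1)
     else (t, 0))"

definition GC_balance :: "real \<Rightarrow> real \<Rightarrow> 'a tree \<Rightarrow> 'a tree \<times> nat" where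
  "GC_balance y z t =
    (let n = wt t [] in
     if wt t [Lft, Lft] > y * n + z then (simple_l t, 1)
     else if wt t [Rgt, Rgt] > y * n + z then (simple_r t, 1)
     else if wt t [Lft, Rgt] > y * n + z then (double_l t, 1)
     else if wt t [Rgt, Lft] > y * n + z then (double_r t, 1)
     else (t, 0))"

fun on_children :: "('a tree \<Rightarrow> 'a tree \<times> nat) \<Rightarrow> 'a tree \<Rightarrow> 'a tree \<times> nat" where
  "on_children f \<langle>\<rangle> = (\<langle>\<rangle>, 0)"
| "on_children f \<langle>l, x, r\<rangle> =
     (let (l', ml) = f l; (r', mr) = f r in (\<langle>l', x, r'\<rangle>, ml + mr))"

definition CGC_balance ::
  "real \<Rightarrow> real \<Rightarrow> real \<Rightarrow> real \<Rightarrow> 'a tree \<Rightarrow> 'a tree \<times> nat" where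
  "CGC_balance u v y y' t =
    (let (t1, m1) = C_balance u v 0 0 t in
     if t \<noteq> t1 then
       (let (t2, m2) = on_children (GC_balance y' 0) t1;
            (t3, m3) = GC_balance y' 0 t2
        in (t3, m1 + m2 + m3))
     else
       (let (t2, m2) = GC_balance y 0 t in (t2, m1 + m2)))"

definition RCGC_balance ::
  "real \<Rightarrow> real \<Rightarrow> real \<Rightarrow> real \<Rightarrow> 'a tree \<Rightarrow> 'a tree \<times> nat" where
  "RCGC_balance u v y y' t =
    (let (t1, m1) = C_balance u v (offset_R u) (offset_R v) t in
     if t \<noteq> t1 then
       (let (t2, m2) = on_children (CGC_balance v v y' y') t1;
            (t3, m3) = GC_balance y' (offset_R y') t2;
            (t4, m4) = on_children (CGC_balance v v y' y') t3
        in (t4, m1 + m2 + m3 + m4))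
     else
       (let (t2, m2) = GC_balance y (offset_R y) t in
        if t \<noteq> t2 then
          (let (t3, m3) = on_children (CGC_balance v v y' y') t2 in (t3, m1 + m2 + m3))
        else (t2, m1 + m2)))"


section \<open>Updates\<close>

datatype 'a upd = Ins (key: 'a) | Del (key: 'a)

fun insert_leaf :: "'a::linorder \<Rightarrow> 'a tree \<Rightarrow> 'a tree" where
  "insert_leaf s \<langle>\<rangle> = \<langle>\<langle>\<rangle>, s, \<langle>\<rangle>\<rangle>"
| "insert_leaf s \<langle>l, x, r\<rangle> =
     (if s < x then \<langle>insert_leaf s l, x, r\<rangle>
      else if x < s then \<langle>l, x, insert_leaf s r\<rangle>
      else \<langle>l, x, r\<rangle>)"

fun delete_leaf :: "'a::linorder \<Rightarrow> 'a tree \<Rightarrow> 'a tree" where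
  "delete_leaf s \<langle>\<rangle> = \<langle>\<rangle>"
| "delete_leaf s \<langle>l, x, r\<rangle> =
     (if s < x then \<langle>delete_leaf s l, x, r\<rangle>
      else if x < s then \<langle>l, x, delete_leaf s r\<rangle>
      else if l = \<langle>\<rangle> \<and> r = \<langle>\<rangle> then \<langle>\<rangle>
      else \<langle>l, x, r\<rangle>)"

fun apply_upd :: "'a::linorder upd \<Rightarrow> 'a tree \<Rightarrow> 'a tree" where
  "apply_upd (Ins s) t = insert_leaf s t"
| "apply_upd (Del s) t = delete_leaf s t"

text \<open>
  A restructuring may return any perfectly balanced tree with the same keys; \<^const>\<open>wbalanced\<close>
  compares the numbers of nodes of siblings, whose difference is that of their weights.
\<close>

definition restructured :: "'a tree \<Rightarrow> 'a tree \<Rightarrow> bool" where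
  "restructured t t' \<longleftrightarrow> inorder t' = inorder t \<and> wbalanced t'"

text \<open>
  In both relations below, the last argument is the number of rotations performed, and a
  restructuring is counted as any number of rotations not exceeding \<open>c\<close>. An update whose key is at
  the root of a tree too large to be restructured is redundant, and stops there. In
  \<open>bottom_up\<close>, the recursive update is non-redundant iff it changed the number of nodes.
\<close>

inductive bottom_up ::
  "real \<Rightarrow> real \<Rightarrow> nat \<Rightarrow> 'a::linorder upd \<Rightarrow> 'a tree \<Rightarrow> 'a tree \<Rightarrow> nat \<Rightarrow> bool"
  for \<alpha> \<beta> :: real and c :: nat and u :: "'a upd" where
  small: "bottom_up \<alpha> \<beta> c u t t' m"
    if "size t \<le> 11" and "restructured (apply_upd u t) t'" and "m \<le> c"
| left: "bottom_up \<alpha> \<beta> c u \<langle>l, x, r\<rangle> t' (m + m')"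
    if "size \<langle>l, x, r\<rangle> > 11" and "key u < x" and "bottom_up \<alpha> \<beta> c u l l' m"
      and "size l' \<noteq> size l"
      and "CGC_balance \<alpha> (alpha_hat \<alpha>) \<beta> (beta_hat \<alpha> \<beta>) \<langle>l', x, r\<rangle> = (t', m')"
| left_redundant: "bottom_up \<alpha> \<beta> c u \<langle>l, x, r\<rangle> \<langle>l', x, r\<rangle> m"
    if "size \<langle>l, x, r\<rangle> > 11" and "key u < x" and "bottom_up \<alpha> \<beta> c u l l' m"
      and "size l' = size l"
| right: "bottom_up \<alpha> \<beta> c u \<langle>l, x, r\<rangle> t' (m + m')"
    if "size \<langle>l, x, r\<rangle> > 11" and "x < key u" and "bottom_up \<alpha> \<beta> c u r r' m"
      and "size r' \<noteq> size r"
      and "CGC_balance \<alpha> (alpha_hat \<alpha>) \<beta> (beta_hat \<alpha> \<beta>) \<langle>l, x, r'\<rangle> = (t', m')"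
| right_redundant: "bottom_up \<alpha> \<beta> c u \<langle>l, x, r\<rangle> \<langle>l, x, r'\<rangle> m"
    if "size \<langle>l, x, r\<rangle> > 11" and "x < key u" and "bottom_up \<alpha> \<beta> c u r r' m"
      and "size r' = size r"
| root: "bottom_up \<alpha> \<beta> c u \<langle>l, x, r\<rangle> \<langle>l, x, r\<rangle> 0"
    if "size \<langle>l, x, r\<rangle> > 11" and "key u = x"

inductive top_down ::
  "real \<Rightarrow> real \<Rightarrow> nat \<Rightarrow> 'a::linorder upd \<Rightarrow> 'a tree \<Rightarrow> 'a tree \<Rightarrow> nat \<Rightarrow> bool"
  for \<alpha> \<beta> :: real and c :: nat and u :: "'a upd" where
  small: "top_down \<alpha> \<beta> c u t t' m"
    if "size t \<le> 29" and "restructured (apply_upd u t) t'" and "m \<le> c"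
| left: "top_down \<alpha> \<beta> c u t \<langle>l', x, r\<rangle> (m + m')"
    if "size t > 29"
      and "RCGC_balance \<alpha> (alpha_hat \<alpha>) \<beta> (beta_hat \<alpha> \<beta>) t = (\<langle>l, x, r\<rangle>, m)"
      and "key u < x" and "top_down \<alpha> \<beta> c u l l' m'"
| right: "top_down \<alpha> \<beta> c u t \<langle>l, x, r'\<rangle> (m + m')"
    if "size t > 29"
      and "RCGC_balance \<alpha> (alpha_hat \<alpha>) \<beta> (beta_hat \<alpha> \<beta>) t = (\<langle>l, x, r\<rangle>, m)"
      and "x < key u" and "top_down \<alpha> \<beta> c u r r' m'"
| root: "top_down \<alpha> \<beta> c u t \<langle>l, x, r\<rangle> m"
    if "size t > 29"
      and "RCGC_balance \<alpha> (alpha_hat \<alpha>) \<beta> (beta_hat \<alpha> \<beta>) t = (\<langle>l, x, r\<rangle>, m)"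
      and "key u = x"

fun effective :: "'a upd \<Rightarrow> 'a tree \<Rightarrow> bool" where
  "effective (Ins s) t \<longleftrightarrow> s \<notin> set_tree t"
| "effective (Del s) t \<longleftrightarrow> \<langle>\<langle>\<rangle>, s, \<langle>\<rangle>\<rangle> \<in> subtrees t"

definition update_step ::
  "real \<Rightarrow> real \<Rightarrow> nat \<Rightarrow> 'a::linorder tree \<Rightarrow> 'a tree \<Rightarrow> nat \<Rightarrow> bool" where
  "update_step \<alpha> \<beta> c t t' m \<longleftrightarrow>
     (\<exists>u. effective u t \<and> (bottom_up \<alpha> \<beta> c u t t' m \<or> top_down \<alpha> \<beta> c u t t' m))"

end

theory Submission
  imports Defs
begin

text \<open>
  The potential of a tree is the sum of the logarithms of its sub-tree weights. Changing the weights
  along the update path by $1$ raises it by a sum of reciprocals of geometrically decreasing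
  weights, hence by $O(1)$. A simple rotation replaces $|n_1|$ by $|n| - |n_{11}|$; when triggered by
  $|n_1| > \<alpha> |n|$ and $|n_{11}| \<ge> (1 - \<alpha>') |n|$, where $\<alpha>'$ is $\<alpha>$ with a hat, it lowers the
  potential by at least $1 - \<alpha>'/\<alpha>$, which is of order $\<eta>$. Every other rotation that starts a
  balancing cascade lowers it by a constant: a double rotation leaves two siblings of total weight $|n|$,
  so that the product of their weights is at most $|n|^2/4$. The further rotations of a cascade are boundedly many
  and never raise the potential. So $O(k/\<eta>)$ rotations are performed, and the term $k/\<epsilon>$ is slack.

  All these estimates need $|n_i| \<le> \<alpha> |n|$ at the nodes below a rotation, but nothing on
  grand-children; this weaker invariant survives every step of the algorithms.
\<close>

section \<open>Potential and balance\<close>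

text \<open>The value 0 at an empty tree is the logarithm of its weight 1.\<close>

fun phi :: "'a tree \<Rightarrow> real" where
  "phi \<langle>\<rangle> = 0"
| "phi \<langle>l, x, r\<rangle> = ln (real (size1 l) + real (size1 r)) + phi l + phi r"

fun cbal :: "real \<Rightarrow> 'a tree \<Rightarrow> bool" where
  "cbal \<alpha> \<langle>\<rangle> \<longleftrightarrow> True"
| "cbal \<alpha> \<langle>l, x, r\<rangle> \<longleftrightarrow>
     real (size1 l) \<le> \<alpha> * (real (size1 l) + real (size1 r)) \<and>
     real (size1 r) \<le> \<alpha> * (real (size1 l) + real (size1 r)) \<and> cbal \<alpha> l \<and> cbal \<alpha> r"

text \<open>
  \<open>loose\<close> allows at the root what an update of weight $1$ or a rotation with rounded thresholds can
  cause; one more \<open>C_balance\<close> step repairs it. The bound $1 - \<alpha> + \<alpha>^2 = \<alpha> + (1 - \<alpha>)^2$ is what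
  the inner child of a simple rotation tolerates.
\<close>

fun loose :: "real \<Rightarrow> 'a tree \<Rightarrow> bool" where
  "loose \<alpha> \<langle>\<rangle> \<longleftrightarrow> True"
| "loose \<alpha> \<langle>l, x, r\<rangle> \<longleftrightarrow>
     real (size1 l) \<le> (1 - \<alpha> + \<alpha>\<^sup>2) * (real (size1 l) + real (size1 r)) \<and>
     real (size1 r) \<le> (1 - \<alpha> + \<alpha>\<^sup>2) * (real (size1 l) + real (size1 r)) \<and> cbal \<alpha> l \<and> cbal \<alpha> r"

text \<open>What a double rotation with rounded thresholds leaves behind: a balanced root whose
  children can each be repaired by one further \<open>C_balance\<close> step.\<close>

fun semi :: "real \<Rightarrow> 'a tree \<Rightarrow> bool" where
  "semi \<alpha> \<langle>\<rangle> \<longleftrightarrow> True"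
| "semi \<alpha> \<langle>l, x, r\<rangle> \<longleftrightarrow>
     real (size1 l) \<le> \<alpha> * (real (size1 l) + real (size1 r)) \<and>
     real (size1 r) \<le> \<alpha> * (real (size1 l) + real (size1 r)) \<and> loose \<alpha> l \<and> loose \<alpha> r"

lemma le_loose_bound: "(\<alpha>::real) \<le> 1 - \<alpha> + \<alpha>\<^sup>2"
  using zero_le_power2[of "1 - \<alpha>"] by (simp add: power2_eq_square algebra_simps)

lemma cbal_imp_loose: "cbal \<alpha> t \<Longrightarrow> loose \<alpha> t"
proof (cases t)
  case (Node l x r)
  have "\<alpha> * (real (size1 l) + real (size1 r)) \<le> (1 - \<alpha> + \<alpha>\<^sup>2) * (real (size1 l) + real (size1 r))"
    by (intro mult_right_mono le_loose_bound) auto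
  then show "cbal \<alpha> t \<Longrightarrow> loose \<alpha> t" using Node by auto
qed simp

lemma cbal_imp_semi: "cbal \<alpha> t \<Longrightarrow> semi \<alpha> t"
  by (cases t) (auto intro: cbal_imp_loose)

lemma phi_nonneg: "0 \<le> phi t"
  by (induction t) (auto intro!: add_nonneg_nonneg ln_ge_zero simp: size1_size)

text \<open>A crude bound for small restructured trees: each node contributes the logarithm of a
  weight that is at most the weight of the whole tree.\<close>

lemma phi_le: "phi t \<le> real (size t) * real (size1 t)"
proof (induction t)
  case (Node l x r)
  let ?n = "real (size1 l) + real (size1 r)"
  have "real (size l) * real (size1 l) \<le> real (size l) * ?n"
    "real (size r) * real (size1 r) \<le> real (size r) * ?n"
    by (auto intro!: mult_left_mono)
  moreover have "ln ?n \<le> ?n"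
    using ln_le_minus_one[of ?n] by (simp add: size1_size)
  moreover have "real (size \<langle>l, x, r\<rangle>) * real (size1 \<langle>l, x, r\<rangle>) = real (size l) * ?n + real (size r) * ?n + ?n"
    by (simp add: algebra_simps)
  ultimately show ?case
    using Node unfolding phi.simps by linarith
qed simp

lemma GCB_imp_cbal: "GCB \<alpha> \<beta> t \<Longrightarrow> cbal \<alpha> t"
proof (induction t)
  case (Node l x r)
  have "balanced_node \<alpha> \<beta> \<langle>l, x, r\<rangle>" "GCB \<alpha> \<beta> l" "GCB \<alpha> \<beta> r"
    using Node.prems by (auto simp: GCB_def)
  moreover have "0 < real (size1 l) + real (size1 r)"
    by (simp add: size1_size)
  ultimately show ?case
    using Node.IH by (simp add: balanced_node_def bal_C_def pos_divide_le_eq)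
qed simp

text \<open>The extreme case is a pair of siblings of weights 1 and 2.\<close>

lemma wbalanced_imp_cbal: "wbalanced t \<Longrightarrow> 2 / 3 \<le> \<alpha> \<Longrightarrow> cbal \<alpha> t"
proof (induction t)
  case (Node l x r)
  let ?n = "real (size1 l) + real (size1 r)"
  have "2 / 3 * ?n \<le> \<alpha> * ?n"
    using Node.prems by (intro mult_right_mono) auto
  with Node show ?case by (auto simp: size1_size)
qed simp

section \<open>Mirror symmetry and sums of sibling weights\<close>

lemma size_mirror: "size (mirror t) = size t"
  by (induction t) auto

lemma phi_mirror: "phi (mirror t) = phi t"
  by (induction t) (auto simp: add.commute)

lemma cbal_mirror: "cbal \<alpha> (mirror t) = cbal \<alpha> t"
  by (induction t) (auto simp: add.commute)

lemma loose_mirror: "loose \<alpha> (mirror t) = loose \<alpha> t"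
  by (cases t) (auto simp: add.commute cbal_mirror)

lemma semi_mirror: "semi \<alpha> (mirror t) = semi \<alpha> t"
  by (cases t) (auto simp: add.commute loose_mirror)

lemma wt_mirror:
  "wt (mirror t) [] = wt t []"
  "wt (mirror t) [Lft] = wt t [Rgt]"
  "wt (mirror t) [Rgt] = wt t [Lft]"
  "wt (mirror t) [Lft, Lft] = wt t [Rgt, Rgt]"
  "wt (mirror t) [Lft, Rgt] = wt t [Rgt, Lft]"
  "wt (mirror t) [Rgt, Lft] = wt t [Lft, Rgt]"
  "wt (mirror t) [Rgt, Rgt] = wt t [Lft, Lft]"
proof -
  show "wt (mirror t) [] = wt t []" for t :: "'a tree" by simp
  then have 1: "wt (mirror t) [Lft] = wt t [Rgt]" "wt (mirror t) [Rgt] = wt t [Lft]" for t :: "'a tree"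
    by (cases t; simp)+
  show "wt (mirror t) [Lft] = wt t [Rgt]" "wt (mirror t) [Rgt] = wt t [Lft]" by (fact 1)+
  show "wt (mirror t) [Lft, Lft] = wt t [Rgt, Rgt]" "wt (mirror t) [Lft, Rgt] = wt t [Rgt, Lft]"
    "wt (mirror t) [Rgt, Lft] = wt t [Lft, Rgt]" "wt (mirror t) [Rgt, Rgt] = wt t [Lft, Lft]"
    by (cases t; simp add: 1)+
qed

lemma mirror_simple_r: "mirror (simple_r t) = simple_l (mirror t)"
  by (cases t rule: simple_r.cases) auto

lemma mirror_double_r: "mirror (double_r t) = double_l (mirror t)"
  by (cases t rule: double_r.cases) auto

lemma wt_children: "wt t [Lft] + wt t [Rgt] = wt t []"
  by (cases t) auto

lemma wt_grandchildren: "wt t [i, Lft] + wt t [i, Rgt] = wt t [i]"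
  using wt_children by (cases t; cases i) auto

section \<open>Progress of a rotation\<close>

text \<open>The drop \<open>g\<close> is charged once to a whole cascade of \<open>m\<close>
  rotations, not to each of them: only the rotation that starts the cascade has to gain. For
  \<open>g = 0\<close> the count is irrelevant.\<close>

definition progress :: "real \<Rightarrow> 'a tree \<Rightarrow> 'a tree \<Rightarrow> nat \<Rightarrow> bool" where
  "progress g t t' m \<longleftrightarrow> size t' = size t \<and> phi t' \<le> phi t \<and> (0 < m \<longrightarrow> phi t' + g \<le> phi t)"

lemma progress_refl: "progress g t t 0"
  by (simp add: progress_def)

lemma progress_trans:
  "progress g t t1 m \<Longrightarrow> progress g t1 t2 m' \<Longrightarrow> progress g t t2 (m + m')"
  by (auto simp: progress_def)

lemma progress_trans0:
  "progress g t t1 m \<Longrightarrow> progress 0 t1 t2 m' \<Longrightarrow> 0 < m \<Longrightarrow> progress g t t2 (m + m')"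
  by (auto simp: progress_def)

lemma progress_mono: "progress g t t' m \<Longrightarrow> 0 \<le> g \<Longrightarrow> progress 0 t t' m'"
  by (auto simp: progress_def)

lemma progress_weaken: "progress g t t' m \<Longrightarrow> g' \<le> g \<Longrightarrow> progress g' t t' m"
  by (auto simp: progress_def)

lemma progress_mirror: "progress g (mirror t) (mirror t') m = progress g t t' m"
  by (simp add: progress_def size_mirror phi_mirror)

lemma ln_drop:
  assumes "0 < (q::real)" "0 < p" "q \<le> (1 - g) * p"
  shows "ln q + g \<le> ln p"
proof -
  have "ln (q / p) \<le> q / p - 1"
    using assms by (intro ln_le_minus_one) auto
  also have "q / p \<le> 1 - g"
    using assms by (simp add: pos_divide_le_eq)
  finally show ?thesis
    using assms by (simp add: ln_div)
qed

text \<open>In the potential only |n_1| changes, to |n| - |n_11|, so \<open>3\<close> gives the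
  drop. Hypothesis \<open>1\<close> keeps the new right child light, and \<open>2\<close> keeps n_2
  light inside it.\<close>

lemma simple_l_cbal:
  fixes t :: "'a tree"
  assumes \<alpha>: "1 / 2 < \<alpha>" "\<alpha> < 3 / 4" and g: "0 \<le> g" and t: "loose \<alpha> t"
    and 1: "(1 - \<alpha>) * wt t [] \<le> wt t [Lft, Lft]"
    and 2: "wt t [] \<le> (1 + \<alpha>) * wt t [Lft]"
    and 3: "wt t [] - wt t [Lft, Lft] \<le> (1 - g) * wt t [Lft]"
  shows "cbal \<alpha> (simple_l t)" "progress g t (simple_l t) m"
proof -
  obtain l x d where t1: "t = \<langle>l, x, d\<rangle>"
    using 2 \<alpha> by (cases t) auto
  have D: "1 \<le> real (size1 d)" by (simp add: size1_size)
  have "l \<noteq> \<langle>\<rangle>"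
  proof
    assume "l = \<langle>\<rangle>"
    then have "(1 + real (size1 d)) \<le> (1 + \<alpha>)" using 2 t1 by simp
    with D \<alpha> show False by linarith
  qed
  then obtain a x1 b where t2: "t = \<langle>\<langle>a, x1, b\<rangle>, x, d\<rangle>"
    using t1 by (cases l) auto
  define A B E where "A = real (size1 a)" and "B = real (size1 b)" and "E = real (size1 d)"
  have pos: "0 < A" "0 < B" "0 < E" by (simp_all add: A_def B_def E_def size1_size)
  have h: "(1 - \<alpha>) * (A + B + E) \<le> A" "A + B + E \<le> (1 + \<alpha>) * (A + B)"
    "B + E \<le> (1 - g) * (A + B)"
    "A + B \<le> (1 - \<alpha> + \<alpha>\<^sup>2) * (A + B + E)" "A \<le> \<alpha> * (A + B)" "B \<le> \<alpha> * (A + B)"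
    "cbal \<alpha> a" "cbal \<alpha> b" "cbal \<alpha> d"
    using 1 2 3 t by (simp_all add: t2 A_def B_def E_def)
  have "\<alpha> * (A + B) \<le> \<alpha> * (A + B + E)"
    using \<alpha> pos by (intro mult_left_mono) auto
  with h have c1: "A \<le> \<alpha> * (A + B + E)" by linarith
  have c2: "B + E \<le> \<alpha> * (A + B + E)" using h(1) by (simp add: algebra_simps)
  \<comment> \<open>Here the bound in \<open>loose\<close> is tight: with N the total weight, B
    \<le> (1 - \<alpha> + \<alpha>^2) N - A and A \<ge> (1 - \<alpha>) N are just enough for B \<le>
    \<alpha> (N - A).\<close>
  have "(1 - \<alpha>) * ((1 - \<alpha>) * (A + B + E)) \<le> (1 - \<alpha>) * A"
    using h(1) \<alpha> by (intro mult_left_mono) auto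
  with h(4) have c3: "B \<le> \<alpha> * (B + E)"
    by (simp add: algebra_simps power2_eq_square)
  \<comment> \<open>As B \<ge> (1 - \<alpha>)(A + B) and E \<le> \<alpha>(A + B), it follows that (1
    - \<alpha>) E \<le> \<alpha> B.\<close>
  have "\<alpha> * A \<le> \<alpha> * (\<alpha> * (A + B))" "(1 - \<alpha>) * (A + B + E) \<le> (1 - \<alpha>) * ((1 + \<alpha>) * (A + B))"
    using h(2,5) \<alpha> by (auto intro!: mult_left_mono)
  then have c4: "E \<le> \<alpha> * (B + E)"
    by (simp add: algebra_simps)
  show "cbal \<alpha> (simple_l t)"
    using c1 c2 c3 c4 h(7-9) by (simp add: t2 A_def B_def E_def add.assoc)
  have "ln (B + E) + g \<le> ln (A + B)"
    using h(3) pos by (intro ln_drop) auto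
  then show "progress g t (simple_l t) m"
    using g by (simp add: progress_def t2 A_def B_def E_def add.assoc)
qed

text \<open>The weights of n_1 and n_12 are replaced by two numbers with sum |n|, hence with product
  at most |n|^2/4; \<open>3\<close> compares this with the old product. The balance of the new
  children depends on the outer sub-trees n_11 and n_2: not heavier than n_12 gives
  \<open>semi\<close>, lighter by the factor \<alpha> gives \<open>cbal\<close>.\<close>

lemma double_l_rotation:
  fixes t :: "'a tree"
  assumes \<alpha>: "1 / 2 < \<alpha>" "\<alpha> < 3 / 4" and g: "0 \<le> g" "g < 1" and t: "loose \<alpha> t"
    and 1: "(1 - \<alpha>) * wt t [] \<le> wt t [Lft, Rgt]"
    and 2: "wt t [] < wt t [Lft] + wt t [Lft, Rgt]"
    and 3: "(wt t [])\<^sup>2 / 4 \<le> (1 - g) * (wt t [Lft] * wt t [Lft, Rgt])"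
  shows "wt t [Lft, Lft] \<le> wt t [Lft, Rgt] \<Longrightarrow> wt t [Rgt] \<le> wt t [Lft, Rgt] \<Longrightarrow> semi \<alpha> (double_l t)"
    and "wt t [Lft, Lft] \<le> \<alpha> * wt t [Lft, Rgt] \<Longrightarrow> wt t [Rgt] \<le> \<alpha> * wt t [Lft, Rgt] \<Longrightarrow>
      cbal \<alpha> (double_l t)"
    and "progress g t (double_l t) m"
proof -
  obtain l x d where t1: "t = \<langle>l, x, d\<rangle>"
    using 2 by (cases t) auto
  have D: "1 \<le> real (size1 d)" by (simp add: size1_size)
  have "l \<noteq> \<langle>\<rangle>" using 2 t1 D by auto
  then obtain a x1 lr where t2: "t = \<langle>\<langle>a, x1, lr\<rangle>, x, d\<rangle>"
    using t1 by (cases l) auto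
  have "lr \<noteq> \<langle>\<rangle>" using 2 t2 D by auto
  then obtain b x12 c where t3: "t = \<langle>\<langle>a, x1, \<langle>b, x12, c\<rangle>\<rangle>, x, d\<rangle>"
    using t2 by (cases lr) auto
  define A B C E where "A = real (size1 a)" and "B = real (size1 b)" and "C = real (size1 c)"
    and "E = real (size1 d)"
  note defs = A_def B_def C_def E_def
  have pos: "0 < A" "0 < B" "0 < C" "0 < E" by (simp_all add: defs size1_size)
  have h: "(1 - \<alpha>) * (A + B + C + E) \<le> B + C" "A + B + C + E < (A + B + C) + (B + C)"
    "(A + B + C + E)\<^sup>2 / 4 \<le> (1 - g) * ((A + B + C) * (B + C))"
    "A + B + C \<le> (1 - \<alpha> + \<alpha>\<^sup>2) * (A + B + C + E)"
    "A \<le> \<alpha> * (A + B + C)" "B + C \<le> \<alpha> * (A + B + C)" "B \<le> \<alpha> * (B + C)" "C \<le> \<alpha> * (B + C)"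
    and cb: "cbal \<alpha> a" "cbal \<alpha> b" "cbal \<alpha> c" "cbal \<alpha> d"
    using 1 2 3 t by (simp_all add: t3 defs add.assoc)
  \<comment> \<open>C is at least (1 - \<alpha>)(B + C), hence at least (1 - \<alpha>)^2 |n|, which
    is the excess of the \<open>loose\<close> bound over \<alpha>.\<close>
  have "(1 - \<alpha>) * ((1 - \<alpha>) * (A + B + C + E)) \<le> (1 - \<alpha>) * (B + C)"
    using h(1) \<alpha> by (intro mult_left_mono) auto
  with h(4,7) have c1: "A + B \<le> \<alpha> * (A + B + C + E)"
    by (simp add: algebra_simps power2_eq_square)
  have "(1 - \<alpha>) * (A + B + C + E) \<le> (1 - \<alpha>) * ((A + B + C) + (B + C))"
    using h(2) \<alpha> by (intro mult_left_mono) auto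
  with h(6,8) have c2: "C + E \<le> \<alpha> * (A + B + C + E)"
    by (simp add: algebra_simps)
  have "(1 - \<alpha>) * B \<le> (1 - \<alpha>) * (\<alpha> * (B + C))"
    using h(7) \<alpha> by (intro mult_left_mono) auto
  moreover have "\<alpha> * A \<le> 1 * A"
    using \<alpha> pos by (intro mult_right_mono) auto
  with h(6) have "(1 - \<alpha>) * (B + C) \<le> A"
    by (simp add: algebra_simps)
  then have "\<alpha> * ((1 - \<alpha>) * (B + C)) \<le> \<alpha> * A"
    using \<alpha> by (intro mult_left_mono) auto
  ultimately have c3: "B \<le> \<alpha> * (A + B)"
    by (simp add: algebra_simps)
  \<comment> \<open>The factor 1 + \<alpha> - \<alpha>^2 nearly inverts the \<open>loose\<close>
    bound: their product is 1 - (\<alpha> - \<alpha>^2)^2 \<le> 1.\<close>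
  have "\<alpha> * (1 - \<alpha>) * (A + B + C) \<le> E"
  proof -
    have "(1 + \<alpha> - \<alpha>\<^sup>2) * (A + B + C) \<le> (1 + \<alpha> - \<alpha>\<^sup>2) * ((1 - \<alpha> + \<alpha>\<^sup>2) * (A + B + C + E))"
      using h(4) \<alpha> power_le_one[of \<alpha> 2] by (intro mult_left_mono) auto
    also have "\<dots> = (1 - (\<alpha> - \<alpha>\<^sup>2)\<^sup>2) * (A + B + C + E)"
      by (simp add: algebra_simps power2_eq_square)
    also have "\<dots> \<le> 1 * (A + B + C + E)"
      using pos by (intro mult_right_mono) auto
    finally show ?thesis by (simp add: algebra_simps power2_eq_square)
  qed
  moreover have "(1 - \<alpha>) * (B + C) \<le> (1 - \<alpha>) * (\<alpha> * (A + B + C))"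
    using h(6) \<alpha> by (intro mult_left_mono) auto
  ultimately have "(1 - \<alpha>) * (B + C) \<le> E"
    by (simp add: algebra_simps)
  then have "\<alpha> * ((1 - \<alpha>) * (B + C)) \<le> \<alpha> * E"
    using \<alpha> by (intro mult_left_mono) auto
  moreover have "(1 - \<alpha>) * C \<le> (1 - \<alpha>) * (\<alpha> * (B + C))"
    using h(8) \<alpha> by (intro mult_left_mono) auto
  ultimately have c4: "C \<le> \<alpha> * (C + E)"
    by (simp add: algebra_simps)
  have b1: "(1 - \<alpha>) * (B + C) \<le> B" and b2: "(1 - \<alpha>) * (B + C) \<le> C"
    using h(7,8) by (simp_all add: algebra_simps)
  \<comment> \<open>In \<open>side\<close> and \<open>side'\<close>, X is the weight of an outer
    sub-tree (A or E) and Y that of the part of n_12 that becomes its sibling (B or C).\<close>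
  have side: "X \<le> \<alpha> * (X + Y)"
    if "X \<le> \<alpha> * (B + C)" "(1 - \<alpha>) * (B + C) \<le> Y" for X Y
  proof -
    have "(1 - \<alpha>) * X \<le> (1 - \<alpha>) * (\<alpha> * (B + C))" "\<alpha> * ((1 - \<alpha>) * (B + C)) \<le> \<alpha> * Y"
      using that \<alpha> by (auto intro!: mult_left_mono simp del: mult_le_cancel_left_pos)
    then show ?thesis by (simp add: algebra_simps)
  qed
  have side': "X \<le> (1 - \<alpha> + \<alpha>\<^sup>2) * (X + Y)"
    if "X \<le> (B + C)" "(1 - \<alpha>) * (B + C) \<le> Y" "0 \<le> Y" for X Y
  proof -
    have "(1 - \<alpha>) * \<alpha> * X \<le> (1 - \<alpha>) * \<alpha> * (B + C)" "\<alpha> * ((1 - \<alpha>) * (B + C)) \<le> \<alpha> * Y"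
      using that \<alpha> by (auto intro!: mult_left_mono simp del: mult_le_cancel_left_pos)
    moreover have "\<alpha> * Y \<le> (1 - \<alpha> + \<alpha>\<^sup>2) * Y"
      using that by (intro mult_right_mono le_loose_bound) auto
    ultimately have "(1 - \<alpha>) * \<alpha> * X \<le> (1 - \<alpha> + \<alpha>\<^sup>2) * Y"
      by (simp add: algebra_simps)
    then show ?thesis by (simp add: algebra_simps power2_eq_square)
  qed
  have mono: "\<alpha> * X \<le> (1 - \<alpha> + \<alpha>\<^sup>2) * X" if "0 \<le> X" for X
    using that by (intro mult_right_mono le_loose_bound)
  show "semi \<alpha> (double_l t)"
    if "wt t [Lft, Lft] \<le> wt t [Lft, Rgt]" "wt t [Rgt] \<le> wt t [Lft, Rgt]"
  proof -
    have "A \<le> B + C" "E \<le> B + C" using that by (simp_all add: t3 defs)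
    then have "A \<le> (1 - \<alpha> + \<alpha>\<^sup>2) * (A + B)" "E \<le> (1 - \<alpha> + \<alpha>\<^sup>2) * (E + C)"
      using b1 b2 pos by (auto intro!: side')
    moreover have "B \<le> (1 - \<alpha> + \<alpha>\<^sup>2) * (A + B)" "C \<le> (1 - \<alpha> + \<alpha>\<^sup>2) * (C + E)"
      using c3 c4 mono[of "A + B"] mono[of "C + E"] pos by linarith+
    ultimately show ?thesis
      using c1 c2 cb by (simp add: t3 defs[symmetric] add_ac)
  qed
  show "cbal \<alpha> (double_l t)"
    if "wt t [Lft, Lft] \<le> \<alpha> * wt t [Lft, Rgt]" "wt t [Rgt] \<le> \<alpha> * wt t [Lft, Rgt]"
  proof -
    have "A \<le> \<alpha> * (B + C)" "E \<le> \<alpha> * (B + C)" using that by (simp_all add: t3 defs)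
    then have "A \<le> \<alpha> * (A + B)" "E \<le> \<alpha> * (E + C)"
      using b1 b2 by (auto intro!: side)
    then show ?thesis
      using c1 c2 c3 c4 cb by (simp add: t3 defs[symmetric] add_ac)
  qed
  have "0 \<le> ((A + B) - (C + E))\<^sup>2" by simp
  then have "(A + B) * (C + E) \<le> (A + B + C + E)\<^sup>2 / 4"
    by (simp add: power2_eq_square algebra_simps)
  with h(3) have "(A + B) * (C + E) \<le> (1 - g) * ((A + B + C) * (B + C))" by linarith
  then have "ln ((A + B) * (C + E)) + g \<le> ln ((A + B + C) * (B + C))"
    using pos by (intro ln_drop mult_pos_pos) auto
  then have "ln (A + B) + ln (C + E) + g \<le> ln (A + B + C) + ln (B + C)"
    using pos by (simp add: ln_mult)
  then show "progress g t (double_l t) m"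
    using g by (simp add: progress_def t3 defs add_ac)
qed

section \<open>Balancing\<close>

lemma wt_root_ge_1: "1 \<le> wt t []"
  by (simp add: size1_size)

lemma cbal_child: "cbal \<alpha> t \<Longrightarrow> 1 / 2 \<le> \<alpha> \<Longrightarrow> wt t [i] \<le> \<alpha> * wt t []"
  by (cases t; cases i) auto

lemma cbal_grandchild: "cbal \<alpha> t \<Longrightarrow> 1 / 2 \<le> \<alpha> \<Longrightarrow> wt t [i, j] \<le> \<alpha> * wt t [i]"
  using cbal_child[of \<alpha> _ j] by (cases t; cases i; cases j) auto

text \<open>In the application \<open>a\<close> and \<open>c\<close> say that the left or right
  child is heavy, \<open>b\<close> and \<open>d\<close> that a double rotation is due. The four
  tests exhaust both heavy cases, so falling through means that no child is heavy.\<close>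

lemma if_cascade:
  assumes "(if a \<and> \<not> b then x1 else if c \<and> \<not> d then x2 else if a \<and> b then x3 else if c \<and> d then x4
    else x5) = y"
  shows "a \<and> \<not> b \<and> x1 = y \<or> c \<and> \<not> d \<and> x2 = y \<or> a \<and> b \<and> x3 = y \<or> c \<and> d \<and> x4 = y \<or>
    \<not> a \<and> \<not> c \<and> x5 = y"
  using assms by (auto split: if_splits)

text \<open>Letting \<open>s\<close> be \<open>t\<close> or its mirror image leaves only
  \<open>simple_l\<close> and \<open>double_l\<close> to analyse.\<close>

lemma C_balance_cases:
  assumes "C_balance u v w x t = (t', m)"
  obtains (none) "m = 0" "t' = t"
      "wt t [Lft] \<le> u * wt t [] + w" "wt t [Rgt] \<le> u * wt t [] + w"
  | (simple) s where "s = t \<and> simple_l s = t' \<or> s = mirror t \<and> simple_l s = mirror t'" "m = 1"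
      "u * wt s [] + w < wt s [Lft]" "(1 - v) * wt s [] - x \<le> wt s [Lft, Lft]"
  | (double) s where "s = t \<and> double_l s = t' \<or> s = mirror t \<and> double_l s = mirror t'" "m = 1"
      "u * wt s [] + w < wt s [Lft]" "wt s [Lft, Lft] < (1 - v) * wt s [] - x"
proof -
  note mir = wt_mirror mirror_simple_r mirror_double_r
  consider "u * wt t [] + w < wt t [Lft]" "(1 - v) * wt t [] - x \<le> wt t [Lft, Lft]" "t' = simple_l t" "m = 1"
    | "u * wt t [] + w < wt t [Rgt]" "(1 - v) * wt t [] - x \<le> wt t [Rgt, Rgt]" "t' = simple_r t" "m = 1"
    | "u * wt t [] + w < wt t [Lft]" "wt t [Lft, Lft] < (1 - v) * wt t [] - x" "t' = double_l t" "m = 1"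
    | "u * wt t [] + w < wt t [Rgt]" "wt t [Rgt, Rgt] < (1 - v) * wt t [] - x" "t' = double_r t" "m = 1"
    | "m = 0" "t' = t" "wt t [Lft] \<le> u * wt t [] + w" "wt t [Rgt] \<le> u * wt t [] + w"
    using if_cascade[OF assms[unfolded C_balance_def Let_def not_less[symmetric]]]
    unfolding not_less[symmetric] prod.inject by blast
  then show thesis
  proof cases
    case 1 then show thesis by (intro simple[of t]) auto
  next
    case 2 then show thesis by (intro simple[of "mirror t"]) (simp_all add: mir del: wt.simps)
  next
    case 3 then show thesis by (intro double[of t]) auto
  next
    case 4 then show thesis by (intro double[of "mirror t"]) (simp_all add: mir del: wt.simps)
  next
    case 5 then show thesis by (rule none)
  qed
qed

lemma GC_balance_cases:
  assumes "GC_balance y z t = (t', m)"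
  obtains (none) "m = 0" "t' = t"
  | (simple) s where "s = t \<and> simple_l s = t' \<or> s = mirror t \<and> simple_l s = mirror t'" "m = 1"
      "y * wt s [] + z < wt s [Lft, Lft]"
  | (double) s where "s = t \<and> double_l s = t' \<or> s = mirror t \<and> double_l s = mirror t'" "m = 1"
      "y * wt s [] + z < wt s [Lft, Rgt]"
proof -
  note mir = wt_mirror mirror_simple_r mirror_double_r
  consider "y * wt t [] + z < wt t [Lft, Lft]" "t' = simple_l t" "m = 1"
    | "y * wt t [] + z < wt t [Rgt, Rgt]" "t' = simple_r t" "m = 1"
    | "y * wt t [] + z < wt t [Lft, Rgt]" "t' = double_l t" "m = 1"
    | "y * wt t [] + z < wt t [Rgt, Lft]" "t' = double_r t" "m = 1"
    | "m = 0" "t' = t"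
    using assms unfolding GC_balance_def Let_def
    by (simp only: prod.inject split: if_split_asm)
  then show thesis
  proof cases
    case 1 then show thesis by (intro simple[of t]) auto
  next
    case 2 then show thesis by (intro simple[of "mirror t"]) (simp_all add: mir del: wt.simps)
  next
    case 3 then show thesis by (intro double[of t]) auto
  next
    case 4 then show thesis by (intro double[of "mirror t"]) (simp_all add: mir del: wt.simps)
  next
    case 5 then show thesis by (rule none)
  qed
qed

lemmas distribs = ring_distribs mult_1_left mult_1_right mult_ac add_0_right diff_zero

text \<open>Here \<open>p\<close> and \<open>q\<close> are numerical lower bounds for |n_1|/|n| and
  |n_12|/|n|, and 499/500 is the least value of 1 - g.\<close>

lemma double_gain:
  assumes "p * N \<le> L" "q * N \<le> (R::real)" "0 \<le> p" "0 \<le> q" "0 \<le> N" "g \<le> 1 / 500"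
    and pq: "1 / 4 \<le> 499 / 500 * (p * q)"
  shows "N\<^sup>2 / 4 \<le> (1 - g) * (L * R)"
proof -
  have "N\<^sup>2 / 4 \<le> 499 / 500 * (p * q) * N\<^sup>2"
    using mult_right_mono[OF pq, of "N\<^sup>2"] by simp
  also have "\<dots> = 499 / 500 * ((p * N) * (q * N))"
    by (simp add: power2_eq_square)
  also have "\<dots> \<le> (1 - g) * (L * R)"
  proof (intro mult_mono)
    have "0 \<le> p * N" "0 \<le> q * N" using assms by simp_all
    with assms show "0 \<le> L" "0 \<le> p * N * (q * N)" by (linarith, simp)
  qed (use assms in simp_all)
  finally show ?thesis .
qed

lemma C_balance_0: "C_balance u v w x t = (t', 0) \<Longrightarrow> t' = t"
  by (erule C_balance_cases) auto

lemma GC_balance_0: "GC_balance y z t = (t', 0) \<Longrightarrow> t' = t"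
  by (erule GC_balance_cases) auto

text \<open>Since \<open>f\<close> keeps sizes, the root stays balanced and only the two sub-trees
  have to be repaired.\<close>

lemma on_children_step:
  assumes f: "\<And>s s' k. P s \<Longrightarrow> f s = (s', k) \<Longrightarrow> cbal \<alpha> s' \<and> progress 0 s s' k \<and> k \<le> M"
    and P: "\<And>l x r. t = \<langle>l, x, r\<rangle> \<Longrightarrow> P l \<and> P r"
    and t: "semi \<alpha> t" and step: "on_children f t = (t', m)"
  shows "cbal \<alpha> t'" "progress 0 t t' m" "m \<le> 2 * M"
proof -
  have "cbal \<alpha> t' \<and> progress 0 t t' m \<and> m \<le> 2 * M"
  proof (cases t)
    case Leaf
    with step show ?thesis by (simp add: progress_refl)
  next
    case (Node l x r)
    obtain l' ml r' mr where lr: "f l = (l', ml)" "f r = (r', mr)" by fastforce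
    with step Node have "t' = \<langle>l', x, r'\<rangle>" "m = ml + mr" by auto
    moreover have "cbal \<alpha> l' \<and> progress 0 l l' ml \<and> ml \<le> M" "cbal \<alpha> r' \<and> progress 0 r r' mr \<and> mr \<le> M"
      using lr P[OF Node] f by blast+
    ultimately show ?thesis
      using t Node by (auto simp: progress_def size1_size)
  qed
  then show "cbal \<alpha> t'" "progress 0 t t' m" "m \<le> 2 * M" by auto
qed

text \<open>As \<open>script_B \<alpha>\<close> is the positive root of y^2 + y = \<alpha>, this
  places y between that root and \<alpha>^2.\<close>

definition ok_bound :: "real \<Rightarrow> real \<Rightarrow> bool" where
  "ok_bound \<alpha> y \<longleftrightarrow> 0 < y \<and> \<alpha> \<le> y * (1 + y) \<and> y \<le> \<alpha>\<^sup>2"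

lemma offset_R_eq: "1 / 2 \<le> x \<Longrightarrow> offset_R x = - x"
  by (simp add: offset_R_def)

text \<open>
  \<open>\<alpha>'\<close> stands for \<^const>\<open>alpha_hat\<close>. The numerical bounds are tight because of \<^const>\<open>double_l\<close>
  with rounded thresholds on a tree of weight $31$: there $|n_1| |n_{12}| / |n|^2$ is only known to exceed $0.252$,
  which has to beat $1/4$.
\<close>

locale gcb_parameters =
  fixes \<alpha> \<alpha>' g :: real
  assumes \<alpha>_gt: "707 / 1000 < \<alpha>" and \<alpha>_lt: "\<alpha> < 3 / 4"
    and \<alpha>'_ge: "707 / 1000 \<le> \<alpha>'" and \<alpha>'_ge2: "1 + \<alpha> \<le> \<alpha>' * (1 + 2 * \<alpha>)"
    and g: "0 < g" "g \<le> 1 / 500" and \<alpha>'_le: "\<alpha>' \<le> (1 - g) * \<alpha>"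
begin

section \<open>Rotations triggered by a heavy child\<close>

lemma \<alpha>'_le_\<alpha>: "\<alpha>' \<le> \<alpha>"
proof -
  have "(1 - g) * \<alpha> \<le> 1 * \<alpha>"
    using g \<alpha>_gt by (intro mult_right_mono) auto
  with \<alpha>'_le show ?thesis by simp
qed

text \<open>Used with \<open>u = \<alpha>\<close>, where \<open>g'\<close> can be positive, and for
  repairs with \<open>u = \<alpha>'\<close>, where the last condition on \<open>g'\<close> forces
  \<open>g' = 0\<close>.\<close>

lemma C_balance_step:
  assumes u: "\<alpha>' \<le> u" "u \<le> \<alpha>" and g': "0 \<le> g'" "g' \<le> 1 / 500" "\<alpha>' \<le> (1 - g') * u"
    and t: "loose \<alpha> t" and step: "C_balance u \<alpha>' 0 0 t = (t', m)"
  shows "cbal \<alpha> t'" "progress g' t t' m" "m \<le> 1"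
proof -
  have "cbal \<alpha> t' \<and> progress g' t t' m \<and> m \<le> 1"
    using step
  proof (cases rule: C_balance_cases)
    case none
    have "u * wt t [] \<le> \<alpha> * wt t []"
      using u by (intro mult_right_mono) auto
    then have "cbal \<alpha> t"
      using none t by (cases t) auto
    with none show ?thesis by (simp add: progress_refl)
  next
    case (simple s)
    define N where "N = wt s []"
    have N: "1 \<le> N" unfolding N_def by (rule wt_root_ge_1)
    have "\<alpha>' * N \<le> \<alpha> * N" "\<alpha>' * N \<le> u * N" "707 / 1000 * N \<le> \<alpha>' * N"
      using N \<alpha>'_le_\<alpha> \<alpha>'_ge u by - (rule mult_right_mono; linarith)+
    moreover from this have L: "707 / 1000 * N \<le> wt s [Lft]" using simple unfolding N_def[symmetric] by linarith
    moreover have "1707 / 1000 * wt s [Lft] \<le> (1 + \<alpha>) * wt s [Lft]"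
      using L N \<alpha>_gt by (intro mult_right_mono) auto
    moreover have "\<alpha>' * N \<le> (1 - g') * u * N"
      using g' N by (intro mult_right_mono) auto
    moreover have "(1 - g') * (u * N) \<le> (1 - g') * wt s [Lft]"
      using simple g' unfolding N_def[symmetric] by (intro mult_left_mono) auto
    ultimately have *: "(1 - \<alpha>) * N \<le> wt s [Lft, Lft]" "N \<le> (1 + \<alpha>) * wt s [Lft]"
      "N - wt s [Lft, Lft] \<le> (1 - g') * wt s [Lft]"
      using simple(3,4) N unfolding N_def[symmetric] by - (simp only: distribs; linarith)+
    have "loose \<alpha> s" using t simple by (auto simp: loose_mirror)
    with * have "cbal \<alpha> (simple_l s)" "progress g' s (simple_l s) m"
      unfolding N_def using \<alpha>_gt \<alpha>_lt g' by (auto intro!: simple_l_cbal[where g = g'] simp del: wt.simps)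
    with simple show ?thesis by (auto simp: cbal_mirror progress_mirror)
  next
    case (double s)
    define N where "N = wt s []"
    have N: "1 \<le> N" unfolding N_def by (rule wt_root_ge_1)
    have LR: "wt s [Lft] = wt s [Lft, Lft] + wt s [Lft, Rgt]" "wt s [Lft] + wt s [Rgt] = N"
      unfolding N_def by (simp_all only: wt_children wt_grandchildren)
    have a: "\<alpha>' * N \<le> \<alpha> * N" "\<alpha>' * N \<le> u * N" "707 / 1000 * N \<le> \<alpha>' * N"
      using N \<alpha>'_le_\<alpha> \<alpha>'_ge u by - (rule mult_right_mono; linarith)+
    have R: "2 * (\<alpha>' * N) - N \<le> wt s [Lft, Rgt]" and L: "\<alpha>' * N \<le> wt s [Lft]"
      and LL: "wt s [Lft, Lft] \<le> N - \<alpha>' * N"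
      using double(3,4) LR a unfolding N_def[symmetric] by - (simp only: distribs; linarith)+
    have 1: "(1 - \<alpha>) * N \<le> wt s [Lft, Rgt]" "N < wt s [Lft] + wt s [Lft, Rgt]"
      using R L a N \<alpha>'_ge by - (simp only: distribs; linarith)+
    have 2: "N\<^sup>2 / 4 \<le> (1 - g') * (wt s [Lft] * wt s [Lft, Rgt])"
    proof (rule double_gain)
      \<comment> \<open>As |n_1| \<ge> \<alpha>'|n| and |n_11| \<le> (1 - \<alpha>')|n|, the share
        of n_12 is at least 2\<alpha>' - 1, and 414/1000 = 2 * 707/1000 - 1.\<close>
      show "707 / 1000 * N \<le> wt s [Lft]" "414 / 1000 * N \<le> wt s [Lft, Rgt]"
        using R L a N by linarith+
    qed (use N g' in auto)
    \<comment> \<open>This is \<open>\<alpha>'_ge2\<close> rearranged: n_11 and n_2 have share at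
      most 1 - \<alpha>', which is at most \<alpha> times the share of n_12.\<close>
    have "(1 - \<alpha>') * N \<le> \<alpha> * (2 * \<alpha>' - 1) * N"
      using \<alpha>'_ge2 N by (intro mult_right_mono) (auto simp: algebra_simps)
    moreover have "\<alpha> * (2 * (\<alpha>' * N) - N) \<le> \<alpha> * wt s [Lft, Rgt]"
      using R \<alpha>_gt by (intro mult_left_mono) auto
    ultimately have 3: "N - \<alpha>' * N \<le> \<alpha> * wt s [Lft, Rgt]"
      by (simp add: algebra_simps)
    have "loose \<alpha> s" using t double by (auto simp: loose_mirror)
    with 1 2 3 LL L LR have "cbal \<alpha> (double_l s)" "progress g' s (double_l s) m"
      unfolding N_def using \<alpha>_gt \<alpha>_lt g'
      by (auto intro!: double_l_rotation(2,3)[where g = g'] simp del: wt.simps)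
    with double show ?thesis by (auto simp: cbal_mirror progress_mirror)
  qed
  then show "cbal \<alpha> t'" "progress g' t t' m" "m \<le> 1" by auto
qed

lemma C_balance_offset_step:
  assumes t: "cbal \<alpha> t" "29 < size t"
    and step: "C_balance \<alpha> \<alpha>' (offset_R \<alpha>) (offset_R \<alpha>') t = (t', m)"
  shows "semi \<alpha> t'" "progress g t t' m" "m \<le> 1"
proof -
  \<comment> \<open>With these offsets the first test is |n_1| > \<alpha>(|n| - 1), and the second
    compares |n| - |n_11| with \<alpha>'(|n| - 1).\<close>
  have off: "offset_R \<alpha> = - \<alpha>" "offset_R \<alpha>' = - \<alpha>'"
    using \<alpha>_gt \<alpha>'_ge by (auto intro!: offset_R_eq)
  have "semi \<alpha> t' \<and> progress g t t' m \<and> m \<le> 1"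
    using step unfolding off
  proof (cases rule: C_balance_cases)
    case none
    with t show ?thesis by (simp add: progress_refl cbal_imp_semi)
  next
    case (simple s)
    define N where "N = wt s []"
    have N: "31 \<le> N" unfolding N_def using t simple by (auto simp: size1_size size_mirror)
    have "707 / 1000 * (N - 1) \<le> \<alpha> * (N - 1)" "(1 - g) * (\<alpha> * (N - 1)) \<le> (1 - g) * wt s [Lft]"
      "\<alpha>' * (N - 1) \<le> (1 - g) * \<alpha> * (N - 1)" "\<alpha>' * (N - 1) \<le> \<alpha> * (N - 1)"
      using N \<alpha>_gt \<alpha>'_le \<alpha>'_le_\<alpha> g less_imp_le[OF simple(3)] unfolding N_def[symmetric]
      by - ((rule mult_right_mono; linarith) | (rule mult_left_mono; simp add: algebra_simps))+
    \<comment> \<open>The constant is 707/1000 * 30/31, rounded down.\<close>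
    moreover from this have L: "684 / 1000 * N \<le> wt s [Lft]"
      using simple(3) N unfolding N_def[symmetric] by - (simp only: distribs; linarith)+
    moreover have "1707 / 1000 * wt s [Lft] \<le> (1 + \<alpha>) * wt s [Lft]"
      using L N \<alpha>_gt by (intro mult_right_mono) auto
    ultimately have *: "(1 - \<alpha>) * N \<le> wt s [Lft, Lft]" "N \<le> (1 + \<alpha>) * wt s [Lft]"
      "N - wt s [Lft, Lft] \<le> (1 - g) * wt s [Lft]"
      using simple(3,4) N \<alpha>_gt \<alpha>'_ge unfolding N_def[symmetric] by - (simp only: distribs; linarith)+
    have "loose \<alpha> s" using t simple by (auto simp: loose_mirror cbal_imp_loose)
    with * have "cbal \<alpha> (simple_l s)" "progress g s (simple_l s) m"
      unfolding N_def using \<alpha>_gt \<alpha>_lt g by (auto intro!: simple_l_cbal[where g = g] simp del: wt.simps)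
    with simple show ?thesis by (auto simp: cbal_mirror progress_mirror cbal_imp_semi)
  next
    case (double s)
    define N where "N = wt s []"
    have N: "31 \<le> N" unfolding N_def using t double by (auto simp: size1_size size_mirror)
    have LR: "wt s [Lft] = wt s [Lft, Lft] + wt s [Lft, Rgt]" "wt s [Lft] + wt s [Rgt] = N"
      unfolding N_def by (simp_all only: wt_children wt_grandchildren)
    have a: "707 / 1000 * (N - 1) \<le> \<alpha> * (N - 1)" "707 / 1000 * (N - 1) \<le> \<alpha>' * (N - 1)"
      using N \<alpha>_gt \<alpha>'_ge by - (rule mult_right_mono; linarith)+
    have d: "\<alpha> * (N - 1) < wt s [Lft]" "wt s [Lft, Lft] < N - \<alpha>' * (N - 1)"
      using double unfolding N_def[symmetric] by (simp_all add: algebra_simps)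
    \<comment> \<open>For |n| \<ge> 31 the share of n_11 is at most 1 - 707/1000 * 30/31 < 316/1000,
      and 368/1000 = 684/1000 - 316/1000. As \<alpha> * 368/1000 < 316/1000, these bounds give
      \<open>semi\<close> but not \<open>cbal\<close>.\<close>
    have L: "684 / 1000 * N \<le> wt s [Lft]" and R: "368 / 1000 * N \<le> wt s [Lft, Rgt]"
      and LL: "wt s [Lft, Lft] \<le> 316 / 1000 * N"
      using d LR a N \<alpha>_lt by - (simp only: distribs; linarith)+
    have "707 / 1000 * N \<le> \<alpha> * N"
      using N \<alpha>_gt by - (rule mult_right_mono; linarith)+
    then have 1: "(1 - \<alpha>) * N \<le> wt s [Lft, Rgt]" "N < wt s [Lft] + wt s [Lft, Rgt]"
      using R L N by - (simp only: distribs; linarith)+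
    have 2: "N\<^sup>2 / 4 \<le> (1 - g) * (wt s [Lft] * wt s [Lft, Rgt])"
      using R L N g by (intro double_gain[of "684 / 1000" _ _ "368 / 1000"]) auto
    have "loose \<alpha> s" using t double by (auto simp: loose_mirror cbal_imp_loose)
    with 1 2 R LL L LR N have "semi \<alpha> (double_l s)" "progress g s (double_l s) m"
      unfolding N_def using \<alpha>_gt \<alpha>_lt g
      by (auto intro!: double_l_rotation(1,3)[where g = g] simp del: wt.simps)
    with double show ?thesis by (auto simp: semi_mirror progress_mirror)
  qed
  then show "semi \<alpha> t'" "progress g t t' m" "m \<le> 1" by auto
qed

section \<open>Rotations triggered by a heavy grand-child\<close>

lemma \<alpha>_sq: "\<alpha>\<^sup>2 \<le> 9 / 16"
  using power_mono[of \<alpha> "3 / 4" 2] \<alpha>_lt \<alpha>_gt by (simp add: power2_eq_square)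

lemma ok_bound_ge:
  assumes "ok_bound \<alpha> y" shows "477 / 1000 \<le> y"
proof (rule ccontr)
  assume "\<not> ?thesis"
  then have "y * (1 + y) \<le> 477 / 1000 * (1 + 477 / 1000)"
    using assms by (intro mult_mono) (auto simp: ok_bound_def)
  with assms \<alpha>_gt show False by (auto simp: ok_bound_def)
qed

lemma ok_bound_imp:
  assumes "ok_bound \<alpha> y" shows "\<alpha> \<le> y * (1 + \<alpha>\<^sup>2)" "\<alpha> \<le> y * (1 + \<alpha>)"
proof -
  have "y * (1 + y) \<le> y * (1 + \<alpha>\<^sup>2)"
    using assms by (intro mult_left_mono) (auto simp: ok_bound_def)
  with assms show 1: "\<alpha> \<le> y * (1 + \<alpha>\<^sup>2)" unfolding ok_bound_def by linarith
  have "\<alpha>\<^sup>2 \<le> \<alpha>" using \<alpha>_gt \<alpha>_lt by (simp add: power2_eq_square)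
  then have "y * (1 + \<alpha>\<^sup>2) \<le> y * (1 + \<alpha>)"
    using assms by (intro mult_left_mono) (auto simp: ok_bound_def)
  with 1 show "\<alpha> \<le> y * (1 + \<alpha>)" by linarith
qed

text \<open>In a balanced tree n_1 is heavier than n_11 by the factor 1/\<alpha> > 4/3, so a heavy
  n_11 supplies the hypotheses of \<open>simple_l_cbal\<close>. The number 458/1000 is what rounding
  at weight 31 leaves of the bound 477/1000 in \<open>ok_bound_ge\<close>.\<close>

lemma heavy_LL:
  assumes t: "cbal \<alpha> t" and y: "458 / 1000 \<le> y" and h: "y * wt t [] < wt t [Lft, Lft]"
  shows "cbal \<alpha> (simple_l t)" "progress g t (simple_l t) m"
proof -
  define N where "N = wt t []"
  have N: "1 \<le> N" unfolding N_def by (rule wt_root_ge_1)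
  have "458 / 1000 * N \<le> y * N" "707 / 1000 * N \<le> \<alpha> * N"
    using N y \<alpha>_gt by - (rule mult_right_mono; linarith)+
  with h have LL: "458 / 1000 * N \<le> wt t [Lft, Lft]" and a: "707 / 1000 * N \<le> \<alpha> * N"
    unfolding N_def[symmetric] by linarith+
  have "wt t [Lft, Lft] \<le> \<alpha> * wt t [Lft]"
    using t \<alpha>_gt by (intro cbal_grandchild) auto
  moreover have "0 \<le> wt t [Lft]"
  proof (rule ccontr)
    assume "\<not> ?thesis"
    then have "\<alpha> * wt t [Lft] \<le> 0" using \<alpha>_gt by (intro mult_nonneg_nonpos) auto
    with calculation LL N show False by linarith
  qed
  moreover from this have "\<alpha> * wt t [Lft] \<le> 3 / 4 * wt t [Lft]" "g * wt t [Lft] \<le> 1 / 500 * wt t [Lft]"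
    "1707 / 1000 * wt t [Lft] \<le> (1 + \<alpha>) * wt t [Lft]"
    using \<alpha>_lt \<alpha>_gt g by - (rule mult_right_mono; linarith)+
  ultimately have "(1 - \<alpha>) * N \<le> wt t [Lft, Lft]" "N \<le> (1 + \<alpha>) * wt t [Lft]"
    "N - wt t [Lft, Lft] \<le> (1 - g) * wt t [Lft]"
    using LL a N by - (simp only: distribs; linarith)+
  then show "cbal \<alpha> (simple_l t)" "progress g t (simple_l t) m"
    unfolding N_def using \<alpha>_gt \<alpha>_lt g t
    by (auto intro!: simple_l_cbal[where g = g] cbal_imp_loose simp del: wt.simps)
qed

lemma heavy_LR:
  assumes t: "cbal \<alpha> t" and y: "458 / 1000 \<le> y" and h: "y * wt t [] < wt t [Lft, Rgt]"
  shows "\<alpha> \<le> y * (1 + \<alpha>\<^sup>2) \<Longrightarrow> \<alpha> \<le> y * (1 + \<alpha>) \<Longrightarrow> cbal \<alpha> (double_l t)"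
    "semi \<alpha> (double_l t)" "progress g t (double_l t) m"
proof -
  define N L R where "N = wt t []" and "L = wt t [Lft]" and "R = wt t [Lft, Rgt]"
  note defs = N_def L_def R_def
  have N: "1 \<le> N" unfolding N_def by (rule wt_root_ge_1)
  have LR: "wt t [Lft, Lft] = L - R" "wt t [Rgt] = N - L"
    unfolding defs using wt_children[of t] wt_grandchildren[of t Lft] by linarith+
  have "458 / 1000 * N \<le> y * N" "707 / 1000 * N \<le> \<alpha> * N" "\<alpha> * N \<le> 3 / 4 * N"
    using N y \<alpha>_gt \<alpha>_lt by - (rule mult_right_mono; linarith)+
  with h have R: "458 / 1000 * N \<le> R" and a: "707 / 1000 * N \<le> \<alpha> * N" "\<alpha> * N \<le> 3 / 4 * N"
    unfolding defs[symmetric] by linarith+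
  have RL: "R \<le> \<alpha> * L" and LN: "L \<le> \<alpha> * N"
    unfolding defs using t \<alpha>_gt by (auto intro!: cbal_grandchild cbal_child simp del: wt.simps)
  have "0 \<le> L"
  proof (rule ccontr)
    assume "\<not> ?thesis"
    then have "\<alpha> * L \<le> 0" using \<alpha>_gt by (intro mult_nonneg_nonpos) auto
    with R RL N show False by linarith
  qed
  then have "\<alpha> * L \<le> 3 / 4 * L" using \<alpha>_lt by (intro mult_right_mono) auto
  with RL have L: "4 / 3 * R \<le> L" by linarith
  have pre: "(1 - \<alpha>) * N \<le> R" "N < L + R" "N\<^sup>2 / 4 \<le> (1 - g) * (L * R)"
  proof -
    show "(1 - \<alpha>) * N \<le> R" "N < L + R"
      using L R a N by - (simp only: distribs; linarith)+
    show "N\<^sup>2 / 4 \<le> (1 - g) * (L * R)"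
      \<comment> \<open>The share of n_1 is at least 4/3 * 458/1000 > 61/100.\<close>
      using L R N g by (intro double_gain[of "61 / 100" _ _ "458 / 1000"]) auto
  qed
  note rot = double_l_rotation[OF _ \<alpha>_lt _ _ cbal_imp_loose[OF t] pre[unfolded defs]]
  show "progress g t (double_l t) m"
    using \<alpha>_gt g by (intro rot) auto
  show "semi \<alpha> (double_l t)"
  proof (rule rot(1))
    show "wt t [Lft, Lft] \<le> wt t [Lft, Rgt]" "wt t [Rgt] \<le> wt t [Lft, Rgt]"
      using LR L LN R a N unfolding R_def[symmetric] by linarith+
  qed (use \<alpha>_gt g in auto)
  show "cbal \<alpha> (double_l t)" if y2: "\<alpha> \<le> y * (1 + \<alpha>\<^sup>2)" "\<alpha> \<le> y * (1 + \<alpha>)"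
  proof -
    \<comment> \<open>Given |n_1| \<le> \<alpha>|n| and |n_12| \<le> \<alpha>|n_1|, the bound on
      n_11 follows from \<alpha>|n| \<le> (1 + \<alpha>)|n_12|, that on n_2 from \<alpha>|n| \<le>
      (1 + \<alpha>^2)|n_12|.\<close>
    have "\<alpha> * N \<le> y * (1 + \<alpha>\<^sup>2) * N" "\<alpha> * N \<le> y * (1 + \<alpha>) * N"
      using y2 N by - (rule mult_right_mono; linarith)+
    moreover have "(1 + \<alpha>\<^sup>2) * (y * N) \<le> (1 + \<alpha>\<^sup>2) * R" "(1 + \<alpha>) * (y * N) \<le> (1 + \<alpha>) * R"
      using h \<alpha>_gt zero_le_power2[of \<alpha>] unfolding defs by - (rule mult_left_mono; linarith)+
    ultimately have *: "\<alpha> * N \<le> (1 + \<alpha>\<^sup>2) * R" "\<alpha> * N \<le> (1 + \<alpha>) * R"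
      by (simp_all add: algebra_simps)
    have "L - R \<le> \<alpha> * R" using LN *(2) by (simp add: algebra_simps)
    moreover have "\<alpha> * (N - L) \<le> \<alpha> * (\<alpha> * R)"
      using RL *(1) by (simp add: algebra_simps power2_eq_square)
    then have "N - L \<le> \<alpha> * R"
      using \<alpha>_gt by (subst (asm) mult_le_cancel_left_pos) auto
    ultimately show ?thesis
      using \<alpha>_gt g LR unfolding defs by (intro rot(2)) auto
  qed
qed

lemma GC_balance_step:
  assumes y: "ok_bound \<alpha> y" and t: "cbal \<alpha> t" and step: "GC_balance y 0 t = (t', m)"
  shows "cbal \<alpha> t'" "progress g t t' m" "m \<le> 1"
proof -
  have y': "458 / 1000 \<le> y" using ok_bound_ge[OF y] by simp
  have "cbal \<alpha> t' \<and> progress g t t' m \<and> m \<le> 1"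
    using step
  proof (cases rule: GC_balance_cases)
    case none
    with t show ?thesis by (simp add: progress_refl)
  next
    case (simple s)
    then have "cbal \<alpha> s" using t by (auto simp: cbal_mirror)
    then have "cbal \<alpha> (simple_l s)" "progress g s (simple_l s) m"
      using simple y' by (auto intro!: heavy_LL[of _ y] simp del: wt.simps)
    with simple show ?thesis by (auto simp: cbal_mirror progress_mirror)
  next
    case (double s)
    then have "cbal \<alpha> s" using t by (auto simp: cbal_mirror)
    then have "cbal \<alpha> (double_l s)" "progress g s (double_l s) m"
      using double y' ok_bound_imp[OF y] by (auto intro!: heavy_LR[of _ y] simp del: wt.simps)
    with double show ?thesis by (auto simp: cbal_mirror progress_mirror)
  qed
  then show "cbal \<alpha> t'" "progress g t t' m" "m \<le> 1" by auto
qed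

lemma GC_balance_offset_step:
  assumes y: "ok_bound \<alpha> y" and t: "cbal \<alpha> t" "29 < size t"
    and step: "GC_balance y (offset_R y) t = (t', m)"
  shows "semi \<alpha> t'" "progress g t t' m" "m \<le> 1"
proof -
  have off: "458 / 1000 * N < X" if "y * N + offset_R y < X" "31 \<le> N" for N X
  proof -
    \<comment> \<open>Both terms of the minimum in \<open>offset_R y\<close> are at least -9/16, as
      477/1000 \<le> y \<le> 9/16; relative to a weight of at least 31 this is less than
      19/1000.\<close>
    have "477 / 1000 * N \<le> y * N" "- 9 / 16 \<le> offset_R y"
      using that ok_bound_ge[OF y] \<alpha>_sq y
      by (simp_all add: offset_R_def ok_bound_def)
    with that show ?thesis by linarith
  qed
  have "semi \<alpha> t' \<and> progress g t t' m \<and> m \<le> 1"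
    using step
  proof (cases rule: GC_balance_cases)
    case none
    with t show ?thesis by (simp add: progress_refl cbal_imp_semi)
  next
    case (simple s)
    then have s: "cbal \<alpha> s" "31 \<le> wt s []" using t by (auto simp: cbal_mirror size1_size size_mirror)
    then have "cbal \<alpha> (simple_l s)" "progress g s (simple_l s) m"
      using off[OF simple(3)] by (auto intro!: heavy_LL simp del: wt.simps)
    with simple show ?thesis by (auto simp: cbal_mirror progress_mirror cbal_imp_semi)
  next
    case (double s)
    then have s: "cbal \<alpha> s" "31 \<le> wt s []" using t by (auto simp: cbal_mirror size1_size size_mirror)
    then have "semi \<alpha> (double_l s)" "progress g s (double_l s) m"
      using off[OF double(3)] by (auto intro!: heavy_LR(2,3) simp del: wt.simps)
    with double show ?thesis by (auto simp: semi_mirror progress_mirror)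
  qed
  then show "semi \<alpha> t'" "progress g t t' m" "m \<le> 1" by auto
qed

section \<open>Composite balancing procedures\<close>

lemma CGC_balance_step:
  assumes u: "\<alpha>' \<le> u" "u \<le> \<alpha>" and g': "0 \<le> g'" "g' \<le> g" "\<alpha>' \<le> (1 - g') * u"
    and y: "ok_bound \<alpha> y" "ok_bound \<alpha> y'"
    and t: "loose \<alpha> t" and step: "CGC_balance u \<alpha>' y y' t = (t', m)"
  shows "cbal \<alpha> t'" "progress g' t t' m" "m \<le> 4"
proof -
  obtain t1 m1 where C: "C_balance u \<alpha>' 0 0 t = (t1, m1)" by fastforce
  have t1: "cbal \<alpha> t1" "progress g' t t1 m1" "m1 \<le> 1"
    using C_balance_step[OF u g'(1) _ g'(3) t C] g' g by auto
  have "cbal \<alpha> t' \<and> progress g' t t' m \<and> m \<le> 4"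
  proof (cases "t = t1")
    case True
    obtain t2 m2 where G: "GC_balance y 0 t1 = (t2, m2)" by fastforce
    have "progress g' t t2 (m1 + m2)"
      using progress_trans[OF t1(2) progress_weaken[OF GC_balance_step(2)[OF y(1) t1(1) G] g'(2)]] .
    with GC_balance_step[OF y(1) t1(1) G] t1 step True C G show ?thesis
      by (simp add: CGC_balance_def)
  next
    case False
    obtain t2 m2 where O: "on_children (GC_balance y' 0) t1 = (t2, m2)" by fastforce
    obtain t3 m3 where G: "GC_balance y' 0 t2 = (t3, m3)" by fastforce
    \<comment> \<open>The tree has changed, so the first rotation was counted and pays for the rest
      of the cascade.\<close>
    have "0 < m1" using False C C_balance_0[of u \<alpha>' 0 0 t t1] by (cases m1) auto
    have GC: "cbal \<alpha> s' \<and> progress 0 s s' k \<and> k \<le> 1" if "cbal \<alpha> s" "GC_balance y' 0 s = (s', k)" for s s' :: "'b tree" and k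
      using GC_balance_step[OF y(2) that] g by (auto intro: progress_mono)
    have "cbal \<alpha> l \<and> cbal \<alpha> r" if "t1 = \<langle>l, x, r\<rangle>" for l x r
      using t1(1) that by simp
    note on_children_step[of "cbal \<alpha>", OF GC this cbal_imp_semi[OF t1(1)] O]
    then have t2: "cbal \<alpha> t2" "progress 0 t1 t2 m2" "m2 \<le> 2"
      by simp_all
    have t3: "cbal \<alpha> t3 \<and> progress 0 t2 t3 m3 \<and> m3 \<le> 1"
      using GC[OF t2(1) G] .
    have "progress g' t t3 (m1 + (m2 + m3))"
      using t1(2) t2(2) t3 \<open>0 < m1\<close> by (blast intro: progress_trans0 progress_trans)
    with t1 t2 t3 step False C O G show ?thesis
      by (simp add: CGC_balance_def add.assoc)
  qed
  then show "cbal \<alpha> t'" "progress g' t t' m" "m \<le> 4" by auto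
qed

text \<open>The count is 1 + 8 + 1 + 8: each rounded step leaves \<open>semi\<close>, and a pass
  over both sub-trees, with at most 4 rotations in each, restores \<open>cbal\<close> without
  raising the potential.\<close>

lemma RCGC_balance_step:
  assumes y: "ok_bound \<alpha> y" "ok_bound \<alpha> y'" and t: "cbal \<alpha> t" "29 < size t"
    and step: "RCGC_balance \<alpha> \<alpha>' y y' t = (t', m)"
  shows "cbal \<alpha> t'" "progress g t t' m" "m \<le> 18"
proof -
  have CGC: "cbal \<alpha> s' \<and> progress 0 s s' k \<and> k \<le> 4"
    if "loose \<alpha> s" "CGC_balance \<alpha>' \<alpha>' y' y' s = (s', k)" for s s' :: "'b tree" and k
    using CGC_balance_step[OF _ _ _ _ _ y(2) y(2) that, of 0] \<alpha>'_le_\<alpha> g by auto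
  have children: "cbal \<alpha> s' \<and> progress 0 s s' k \<and> k \<le> 8"
    if "semi \<alpha> s" "on_children (CGC_balance \<alpha>' \<alpha>' y' y') s = (s', k)" for s s' :: "'b tree" and k
    using on_children_step[of "loose \<alpha>", OF CGC _ that] that(1) by (cases s) auto
  obtain t1 m1 where C: "C_balance \<alpha> \<alpha>' (offset_R \<alpha>) (offset_R \<alpha>') t = (t1, m1)" by fastforce
  note t1 = C_balance_offset_step[OF t C]
  have "cbal \<alpha> t' \<and> progress g t t' m \<and> m \<le> 18"
  proof (cases "t = t1")
    case False
    obtain t2 m2 where 2: "on_children (CGC_balance \<alpha>' \<alpha>' y' y') t1 = (t2, m2)" by fastforce
    obtain t3 m3 where 3: "GC_balance y' (offset_R y') t2 = (t3, m3)" by fastforce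
    obtain t4 m4 where 4: "on_children (CGC_balance \<alpha>' \<alpha>' y' y') t3 = (t4, m4)" by fastforce
    have "0 < m1" using False C C_balance_0[of \<alpha> \<alpha>' _ _ t t1] by (cases m1) auto
    have t2: "cbal \<alpha> t2" "progress 0 t1 t2 m2" "m2 \<le> 8"
      using children[OF t1(1) 2] by auto
    then have "29 < size t2" using t t1(2) by (simp add: progress_def)
    note t3 = GC_balance_offset_step[OF y(2) t2(1) this 3]
    note t4 = children[OF t3(1) 4]
    have "progress 0 t2 t3 m3" using t3(2) g by (auto intro: progress_mono)
    then have "progress g t t4 (m1 + (m2 + (m3 + m4)))"
      using t1(2) t2(2) t4 \<open>0 < m1\<close> by (blast intro: progress_trans0 progress_trans)
    with t1 t2 t3 t4 step False C 2 3 4 show ?thesis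
      by (simp add: RCGC_balance_def add.assoc)
  next
    case True
    obtain t2 m2 where 2: "GC_balance y (offset_R y) t1 = (t2, m2)" by fastforce
    note t2 = GC_balance_offset_step[OF y(1) t[unfolded True] 2]
    have p: "progress g t t2 (m1 + m2)"
      using progress_trans[OF t1(2) t2(2)] .
    show ?thesis
    proof (cases "t1 = t2")
      case eq: True
      with p t1 t2 t step True C 2 show ?thesis by (simp add: RCGC_balance_def)
    next
      case False
      obtain t3 m3 where 3: "on_children (CGC_balance \<alpha>' \<alpha>' y' y') t2 = (t3, m3)" by fastforce
      note t3 = children[OF t2(1) 3]
      have "0 < m2" using False 2 GC_balance_0[of y _ t1 t2] by (cases m2) auto
      then have "progress g t t3 (m1 + m2 + m3)"
        using p t3 by (intro progress_trans0[of g t t2 "m1 + m2"]) auto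
      with t1 t2 t3 step False True C 2 3 show ?thesis
        by (simp add: RCGC_balance_def)
    qed
  qed
  then show "cbal \<alpha> t'" "progress g t t' m" "m \<le> 18" by auto
qed

end

section \<open>Updates\<close>

lemma size_apply_upd: "size (apply_upd u t) \<le> Suc (size t)" "size t \<le> Suc (size (apply_upd u t))"
proof -
  have "size (insert_leaf s t) \<le> Suc (size t) \<and> size t \<le> size (insert_leaf s t)"
    "size (delete_leaf s t) \<le> size t \<and> size t \<le> Suc (size (delete_leaf s t))" for s :: 'a and t
    by (induction t) auto
  then show "size (apply_upd u t) \<le> Suc (size t)" "size t \<le> Suc (size (apply_upd u t))"
    by (cases u; simp add: le_SucI)+
qed

lemma size_restructured: "restructured t t' \<Longrightarrow> size t' = size t"
  by (metis restructured_def length_inorder)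

text \<open>
  The term \<open>3 / size1 t\<close> absorbs the harmonic sum of the sub-tree weights on the update path, since
  these weights shrink by at least the factor $3/4$ at each step.
\<close>

definition amortised :: "real \<Rightarrow> real \<Rightarrow> 'a tree \<Rightarrow> 'a tree \<Rightarrow> nat \<Rightarrow> bool" where
  "amortised h C t t' m \<longleftrightarrow>
     size t' \<le> Suc (size t) \<and> phi t' + h * real m \<le> phi t + C - 3 / real (size1 t)"

lemma amortised_mirror: "amortised h C (mirror t) (mirror t') m = amortised h C t t' m"
  by (simp add: amortised_def phi_mirror size_mirror)

text \<open>The result has at most 30 nodes, hence potential at most 930; the rest of the 1000
  covers 3 / \<open>size1 t\<close> \<le> 3, and \<open>c\<close> covers the rotations.\<close>

lemma amortised_small:
  assumes t: "size t \<le> 29" and r: "restructured (apply_upd u t) t'" and m: "m \<le> c"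
    and h: "0 \<le> h" "h \<le> 1"
  shows "amortised h (1000 + real c) t t' m"
proof -
  have s: "size t' \<le> Suc (size t)"
    using size_apply_upd(1)[of u t] size_restructured[OF r] by simp
  have "phi t' \<le> real (size t') * real (size1 t')" by (rule phi_le)
  also have "\<dots> \<le> 30 * 31"
    using s t by (intro mult_mono) (auto simp: size1_size)
  finally have "phi t' \<le> 930" by simp
  moreover have "h * real m \<le> 1 * real c"
    using m h by (intro mult_mono) auto
  moreover have "3 / real (size1 t) \<le> 3" by (simp add: size1_size divide_le_eq)
  ultimately show ?thesis using s phi_nonneg[of t] by (simp add: amortised_def)
qed

text \<open>With L the weight of the left sub-tree and N that of the root, the logarithm at the root
  grows by at most 1/N, and 3/L \<ge> 4/N = 3/N + 1/N pays for it.\<close>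

lemma amortised_left:
  assumes "amortised h C l l' m" and l: "size1 l \<le> 3 / 4 * (real (size1 l) + real (size1 r))"
  shows "amortised h C \<langle>l, x, r\<rangle> \<langle>l', x, r\<rangle> m"
proof -
  define L R where "L = real (size1 l)" and "R = real (size1 r)"
  have pos: "0 < L" "0 < R" by (auto simp: L_def R_def size1_size)
  have L': "0 < real (size1 l')" "real (size1 l') \<le> L + 1"
    using assms by (auto simp: L_def size1_size amortised_def)
  have "ln (real (size1 l') + R) \<le> ln (L + R + 1)"
    using L' pos by (subst ln_le_cancel_iff) auto
  also have "L + R + 1 = (L + R) * (1 + 1 / (L + R))"
    using pos by (simp add: field_simps)
  also have "ln \<dots> = ln (L + R) + ln (1 + 1 / (L + R))"
    using pos by (intro ln_mult_pos) (auto intro: add_pos_pos)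
  also have "ln (1 + 1 / (L + R)) \<le> 1 / (L + R)"
    using pos by (intro ln_add_one_self_le_self) auto
  finally have 1: "ln (real (size1 l') + R) \<le> ln (L + R) + 1 / (L + R)" by simp
  have "4 / (L + R) \<le> 3 / L"
    using l pos by (simp add: L_def[symmetric] R_def[symmetric] field_simps)
  moreover have "4 / (L + R) = 3 / (L + R) + 1 / (L + R)"
    by (simp add: add_divide_distrib[symmetric])
  ultimately show ?thesis
    using assms(1) 1 by (simp add: amortised_def L_def R_def)
qed

lemma amortised_right:
  assumes "amortised h C r r' m" and "size1 r \<le> 3 / 4 * (real (size1 l) + real (size1 r))"
  shows "amortised h C \<langle>l, x, r\<rangle> \<langle>l, x, r'\<rangle> m"
proof -
  have "amortised h C (mirror \<langle>l, x, r\<rangle>) (mirror \<langle>l, x, r'\<rangle>) m"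
    using assms by (auto intro!: amortised_left simp: amortised_mirror add.commute)
  then show ?thesis by (simp only: amortised_mirror)
qed

text \<open>Spreads the single drop of a cascade over its at most 18 rotations.\<close>

lemma progress_scaled:
  assumes "progress g t t' m" "m \<le> 18" "0 \<le> g"
  shows "phi t' + g / 18 * real m \<le> phi t"
proof (cases "m = 0")
  case False
  have "g / 18 * real m \<le> g / 18 * 18"
    using assms by (intro mult_left_mono) auto
  with assms False show ?thesis by (simp add: progress_def)
qed (use assms in \<open>simp add: progress_def\<close>)

lemma amortised_progress:
  assumes "amortised (g / 18) C t t1 m" "progress g t1 t2 m'" "m' \<le> 18" "0 \<le> g"
  shows "amortised (g / 18) C t t2 (m + m')"
  using assms(1) progress_scaled[OF assms(2-4)] assms(2)
  by (simp add: amortised_def distrib_left progress_def)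

lemma progress_amortised:
  assumes "progress g t t1 m" "m \<le> 18" "0 \<le> g" "amortised (g / 18) C t1 t2 m'"
  shows "amortised (g / 18) C t t2 (m + m')"
  using progress_scaled[OF assms(1-3)] assms(1,4)
  by (simp add: amortised_def distrib_left progress_def size1_size)

lemma amortised_refl:
  assumes "3 \<le> C" shows "amortised h C t t 0"
proof -
  have "3 / real (size1 t) \<le> 3" by (simp add: size1_size divide_le_eq)
  with assms show ?thesis by (simp add: amortised_def)
qed

text \<open>A change by 1 exceeds the old bounds by at most \<alpha> or 1 - \<alpha>. The new weight
  is at least 12, so the excess (1 - \<alpha>)^2 of the \<open>loose\<close> bound is worth at least
  12/16 = 3/4 \<ge> \<alpha> and at least 3(1 - \<alpha>).\<close>

lemma update_loose:
  fixes L R L' :: real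
  assumes \<alpha>: "2 / 3 \<le> \<alpha>" "\<alpha> \<le> 3 / 4" and b: "L \<le> \<alpha> * (L + R)" "R \<le> \<alpha> * (L + R)"
    and n: "13 \<le> L + R" and L': "L' = L + 1 \<or> L' = L - 1"
  shows "L' \<le> (1 - \<alpha> + \<alpha>\<^sup>2) * (L' + R)" "R \<le> (1 - \<alpha> + \<alpha>\<^sup>2) * (L' + R)"
proof -
  have sq: "1 - \<alpha> + \<alpha>\<^sup>2 = \<alpha> + (1 - \<alpha>) * (1 - \<alpha>)"
    by (simp add: power2_eq_square algebra_simps)
  have N': "12 \<le> L' + R" using L' n by auto
  have 4: "1 / 4 * (1 / 4) \<le> (1 - \<alpha>) * (1 - \<alpha>)"
    using \<alpha> by (intro mult_mono) auto
  have "(1 - \<alpha>) * (1 - \<alpha>) * 12 \<le> (1 - \<alpha>) * (1 - \<alpha>) * (L' + R)"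
    using N' by (intro mult_left_mono) auto
  moreover have "1 / 4 * (1 - \<alpha>) \<le> (1 - \<alpha>) * (1 - \<alpha>)"
    using \<alpha> by (intro mult_right_mono) auto
  ultimately have slack: "\<alpha> \<le> (1 - \<alpha>) * (1 - \<alpha>) * (L' + R)" "1 - \<alpha> \<le> (1 - \<alpha>) * (1 - \<alpha>) * (L' + R)"
    using 4 \<alpha> by linarith+
  have "\<alpha> * (L + R - 1) \<le> \<alpha> * (L' + R)"
    using L' \<alpha> by (intro mult_left_mono) auto
  then have e: "\<alpha> * (L + R) - \<alpha> \<le> \<alpha> * (L' + R)"
    by (simp add: algebra_simps)
  have "L' \<le> \<alpha> * (L' + R) + (1 - \<alpha>) * (1 - \<alpha>) * (L' + R)"
  proof (cases "L' = L + 1")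
    case True
    then have "\<alpha> * (L' + R) = \<alpha> * (L + R) + \<alpha>" by (simp add: algebra_simps)
    with True slack b show ?thesis by linarith
  next
    case False
    with L' have "L' = L - 1" by simp
    moreover from this have "\<alpha> * (L' + R) = \<alpha> * (L + R) - \<alpha>"
      by (simp only: right_diff_distrib distrib_left)
    ultimately show ?thesis using slack b by linarith
  qed
  then show "L' \<le> (1 - \<alpha> + \<alpha>\<^sup>2) * (L' + R)"
    unfolding sq by (simp only: distrib_right)
  have "R \<le> \<alpha> * (L' + R) + (1 - \<alpha>) * (1 - \<alpha>) * (L' + R)"
    using e slack b \<alpha> by linarith
  then show "R \<le> (1 - \<alpha> + \<alpha>\<^sup>2) * (L' + R)"
    unfolding sq by (simp only: distrib_right)
qed

lemma loose_update_left:
  assumes \<alpha>: "2 / 3 \<le> \<alpha>" "\<alpha> \<le> 3 / 4" and t: "cbal \<alpha> \<langle>l, x, r\<rangle>" "11 < size \<langle>l, x, r\<rangle>"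
    and l': "cbal \<alpha> l'" "size l' \<le> Suc (size l)" "size l \<le> Suc (size l')" "size l' \<noteq> size l"
  shows "loose \<alpha> \<langle>l', x, r\<rangle>"
proof -
  have "size l' = Suc (size l) \<or> size l = Suc (size l')" using l' by linarith
  then have "real (size1 l') = real (size1 l) + 1 \<or> real (size1 l') = real (size1 l) - 1"
    by (auto simp: size1_size)
  moreover have "13 \<le> real (size1 l) + real (size1 r)" using t(2) by (simp add: size1_size)
  ultimately show ?thesis
    using update_loose[OF \<alpha>, of "size1 l" "size1 r" "size1 l'"] t(1) l'(1) by simp
qed

lemma loose_update_right:
  assumes \<alpha>: "2 / 3 \<le> \<alpha>" "\<alpha> \<le> 3 / 4" and t: "cbal \<alpha> \<langle>l, x, r\<rangle>" "11 < size \<langle>l, x, r\<rangle>"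
    and r': "cbal \<alpha> r'" "size r' \<le> Suc (size r)" "size r \<le> Suc (size r')" "size r' \<noteq> size r"
  shows "loose \<alpha> \<langle>l, x, r'\<rangle>"
proof -
  have "loose \<alpha> (mirror \<langle>l, x, r'\<rangle>)"
    unfolding mirror.simps
    using t r' cbal_mirror[of \<alpha> "\<langle>l, x, r\<rangle>"]
    by (intro loose_update_left[OF \<alpha>, of "mirror r"]) (auto simp: size_mirror cbal_mirror)
  then show ?thesis by (simp only: loose_mirror)
qed

section \<open>Amortised cost of the update algorithms\<close>

locale gcb_algorithm = gcb_parameters \<alpha> "alpha_hat \<alpha>" g for \<alpha> g +
  fixes \<beta> :: real and c :: nat
  assumes ok: "ok_bound \<alpha> \<beta>" "ok_bound \<alpha> (beta_hat \<alpha> \<beta>)"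
begin

lemma \<alpha>_bounds: "2 / 3 \<le> \<alpha>" "\<alpha> \<le> 3 / 4"
  using \<alpha>_gt \<alpha>_lt by auto

lemma cbal_child_le:
  assumes "cbal \<alpha> \<langle>l, x, r\<rangle>"
  shows "real (size1 l) \<le> 3 / 4 * (real (size1 l) + real (size1 r))"
    "real (size1 r) \<le> 3 / 4 * (real (size1 l) + real (size1 r))"
proof -
  have "\<alpha> * (real (size1 l) + real (size1 r)) \<le> 3 / 4 * (real (size1 l) + real (size1 r))"
    using \<alpha>_lt by (intro mult_right_mono) auto
  with assms show "real (size1 l) \<le> 3 / 4 * (real (size1 l) + real (size1 r))"
    "real (size1 r) \<le> 3 / 4 * (real (size1 l) + real (size1 r))" by auto
qed

lemma CGC_step:
  assumes "loose \<alpha> t" "CGC_balance \<alpha> (alpha_hat \<alpha>) \<beta> (beta_hat \<alpha> \<beta>) t = (t', m)"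
  shows "cbal \<alpha> t'" "progress g t t' m" "m \<le> 18" "size t' = size t"
proof -
  note * = CGC_balance_step[OF \<alpha>'_le_\<alpha> order_refl _ order_refl \<alpha>'_le ok assms]
  show "cbal \<alpha> t'" "progress g t t' m" "m \<le> 18" using * g by auto
  then show "size t' = size t" by (simp add: progress_def)
qed

text \<open>The lower bound on the new size is carried along because, with the upper bound in
  \<open>amortised\<close>, it makes a non-redundant update change the size by exactly 1, as
  \<open>loose_update_left\<close> needs.\<close>

lemma bottom_up_amortised:
  assumes "bottom_up \<alpha> \<beta> c u t t' m" "cbal \<alpha> t"
  shows "cbal \<alpha> t' \<and> size t \<le> Suc (size t') \<and> amortised (g / 18) (1000 + real c) t t' m"
  using assms
proof (induction rule: bottom_up.induct)
  case (small t t' m)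
  then have "size t' = size (apply_upd u t)" by (intro size_restructured)
  with small show ?case
    using g \<alpha>_bounds size_apply_upd[where u = u and t = t]
    by (auto intro!: amortised_small wbalanced_imp_cbal simp: restructured_def)
next
  case (left l x r l' m t' m')
  then have l': "cbal \<alpha> l'" "size l \<le> Suc (size l')" "amortised (g / 18) (1000 + real c) l l' m"
    by auto
  then have "size l' \<le> Suc (size l)" by (simp add: amortised_def)
  then have "loose \<alpha> \<langle>l', x, r\<rangle>"
    using left l' by (intro loose_update_left[OF \<alpha>_bounds, of l]) auto
  note step = CGC_step[OF this left.hyps(5)]
  have "amortised (g / 18) (1000 + real c) \<langle>l, x, r\<rangle> \<langle>l', x, r\<rangle> m"
    using l'(3) cbal_child_le(1)[OF left.prems] by (rule amortised_left)
  from amortised_progress[OF this step(2,3)] g step l' show ?case by simp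
next
  case (left_redundant l x r l' m)
  then show ?case
    using cbal_child_le(1)[OF left_redundant.prems] by (auto intro!: amortised_left simp: size1_size)
next
  case (right l x r r' m t' m')
  then have r': "cbal \<alpha> r'" "size r \<le> Suc (size r')" "amortised (g / 18) (1000 + real c) r r' m"
    by auto
  then have "size r' \<le> Suc (size r)" by (simp add: amortised_def)
  then have "loose \<alpha> \<langle>l, x, r'\<rangle>"
    using right r' by (intro loose_update_right[OF \<alpha>_bounds, of _ _ r]) auto
  note step = CGC_step[OF this right.hyps(5)]
  have "amortised (g / 18) (1000 + real c) \<langle>l, x, r\<rangle> \<langle>l, x, r'\<rangle> m"
    using r'(3) cbal_child_le(2)[OF right.prems] by (rule amortised_right)
  from amortised_progress[OF this step(2,3)] g step r' show ?case by simp
next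
  case (right_redundant l x r r' m)
  then show ?case
    using cbal_child_le(2)[OF right_redundant.prems] by (auto intro!: amortised_right simp: size1_size)
next
  case (root l x r)
  then show ?case by (simp add: amortised_refl)
qed

text \<open>Balancing precedes the descent, so every recursive call starts from a balanced
  sub-tree.\<close>

lemma top_down_amortised:
  assumes "top_down \<alpha> \<beta> c u t t' m" "cbal \<alpha> t"
  shows "amortised (g / 18) (1000 + real c) t t' m"
  using assms
proof (induction rule: top_down.induct)
  case (small t t' m)
  then show ?case using g by (intro amortised_small) auto
next
  case (left t l x r m l' m')
  note step = RCGC_balance_step[OF ok left.prems left.hyps(1,2)]
  have "amortised (g / 18) (1000 + real c) \<langle>l, x, r\<rangle> \<langle>l', x, r\<rangle> m'"
    using left step(1) cbal_child_le(1)[OF step(1)] by (intro amortised_left) auto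
  then show ?case using progress_amortised[OF step(2,3)] g by simp
next
  case (right t l x r m r' m')
  note step = RCGC_balance_step[OF ok right.prems right.hyps(1,2)]
  have "amortised (g / 18) (1000 + real c) \<langle>l, x, r\<rangle> \<langle>l, x, r'\<rangle> m'"
    using right step(1) cbal_child_le(2)[OF step(1)] by (intro amortised_right) auto
  then show ?case using progress_amortised[OF step(2,3)] g by simp
next
  case (root t l x r m)
  note step = RCGC_balance_step[OF ok root.prems root.hyps(1,2)]
  show ?case
    using progress_amortised[OF step(2,3), of "1000 + real c" "\<langle>l, x, r\<rangle>" 0] g
    by (simp add: amortised_refl)
qed

lemma update_step_amortised:
  assumes "update_step \<alpha> \<beta> c t t' m" "cbal \<alpha> t"
  shows "phi t' + g / 18 * real m \<le> phi t + (1000 + real c)"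
proof -
  have "amortised (g / 18) (1000 + real c) t t' m"
    using assms bottom_up_amortised top_down_amortised by (auto simp: update_step_def)
  moreover have "0 \<le> 3 / real (size1 t)" by simp
  ultimately show ?thesis unfolding amortised_def by linarith
qed

text \<open>Telescoping: the potential starts at 0 and is never negative.\<close>

lemma total_rotations:
  assumes "T 0 = \<langle>\<rangle>" "\<And>l. l < k \<Longrightarrow> cbal \<alpha> (T l)"
    and "\<And>l. l < k \<Longrightarrow> update_step \<alpha> \<beta> c (T l) (T (Suc l)) (m l)"
  shows "g / 18 * real (\<Sum>l<k. m l) \<le> real k * (1000 + real c)"
proof -
  have "phi (T k) + g / 18 * real (\<Sum>l<k. m l) \<le> real k * (1000 + real c)"
    using assms(2,3)
  proof (induction k)
    case 0
    then show ?case using assms(1) by simp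
  next
    case (Suc k)
    have "phi (T (Suc k)) + g / 18 * real (m k) \<le> phi (T k) + (1000 + real c)"
      using Suc.prems by (intro update_step_amortised) auto
    with Suc show ?case by (simp add: algebra_simps)
  qed
  with phi_nonneg[of "T k"] show ?thesis by linarith
qed

end

section \<open>Parameters\<close>

lemma eta_alpha_bounds:
  assumes "1 / sqrt 2 < \<alpha>" "\<alpha> < 3 / 4"
  shows "0 < eta \<alpha>" "eta \<alpha> \<le> 43 / 1000" "707 / 1000 < \<alpha>" "14 / 5 * eta \<alpha> \<le> 2 * \<alpha>\<^sup>2 - 1"
proof -
  show eta: "0 < eta \<alpha>" using assms by (simp add: eta_def)
  have s: "1414 / 1000 \<le> sqrt 2" by (rule real_le_rsqrt) (simp add: power2_eq_square)
  have inv: "1 / sqrt 2 = sqrt 2 / 2" by (simp add: field_simps)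
  show "707 / 1000 < \<alpha>" "eta \<alpha> \<le> 43 / 1000"
    using assms s unfolding eta_def inv by linarith+
  have "2 * \<alpha>\<^sup>2 - 1 = 2 * (\<alpha> + sqrt 2 / 2) * eta \<alpha>"
    unfolding eta_def inv by (simp add: power2_eq_square algebra_simps)
  moreover have "14 / 5 * eta \<alpha> \<le> 2 * (\<alpha> + sqrt 2 / 2) * eta \<alpha>"
    using assms s eta unfolding inv by (intro mult_right_mono) auto
  ultimately show "14 / 5 * eta \<alpha> \<le> 2 * \<alpha>\<^sup>2 - 1" by linarith
qed

text \<open>At \<alpha> = 1/sqrt 2 the value of \<open>alpha_hat\<close> is \<alpha> itself and the
  last two bounds are equalities; their proofs therefore split off the factor 2\<alpha>^2 - 1, which
  vanishes there.\<close>

lemma alpha_hat_bounds: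
  assumes a: "1 / sqrt 2 < \<alpha>" "\<alpha> < 3 / 4"
  shows "707 / 1000 \<le> alpha_hat \<alpha>" "1 + \<alpha> \<le> alpha_hat \<alpha> * (1 + 2 * \<alpha>)"
    "alpha_hat \<alpha> \<le> (1 - eta \<alpha> / 25) * \<alpha>"
proof -
  note b = eta_alpha_bounds[OF a]
  define s where "s = sqrt ((1 - \<alpha>) * (5 - \<alpha>))"
  have ah: "alpha_hat \<alpha> = (1 - 2 * \<alpha> + 6 * \<alpha>\<^sup>2 - s) / (5 * (2 * \<alpha> - 1))"
    by (simp add: alpha_hat_def s_def)
  have pos: "0 < 5 * (2 * \<alpha> - 1)" using b by simp
  define d where "d = \<alpha> - 707 / 1000"
  have d: "0 \<le> d" "d \<le> 43 / 1000" "\<alpha> = 707 / 1000 + d" using a b by (auto simp: d_def)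
  \<comment> \<open>The slope 586/1000 is that of the linear term on the other side, so that only
    1.1216 and 1.121604 have to be compared.\<close>
  have "s \<le> 11216 / 10000 - 586 / 1000 * d"
    unfolding s_def
  proof (rule real_le_lsqrt)
    show "0 \<le> (11216 / 10000 - 586 / 1000 * d :: real)" using d by simp
    have "d * d \<le> 43 / 1000 * d" using d by (intro mult_right_mono) auto
    moreover have "(11216 / 10000 - 586 / 1000 * d)\<^sup>2 - (1 - \<alpha>) * (5 - \<alpha>) =
        13756 / 100000000 + 32714848 / 10000000 * d - 656604 / 1000000 * (d * d)"
      unfolding d(3) by (simp add: power2_eq_square field_simps)
    ultimately show "(1 - \<alpha>) * (5 - \<alpha>) \<le> (11216 / 10000 - 586 / 1000 * d)\<^sup>2"
      using d by linarith
  qed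
  moreover have "1 - 2 * \<alpha> + 6 * \<alpha>\<^sup>2 - 707 / 1000 * (5 * (2 * \<alpha> - 1)) =
      1121604 / 1000000 - 586 / 1000 * d + 6 * (d * d)"
    unfolding d(3) by (simp add: power2_eq_square field_simps)
  moreover have "0 \<le> d * d" by simp
  ultimately have "707 / 1000 * (5 * (2 * \<alpha> - 1)) \<le> 1 - 2 * \<alpha> + 6 * \<alpha>\<^sup>2 - s"
    by linarith
  then show "707 / 1000 \<le> alpha_hat \<alpha>"
    unfolding ah using pos by (simp add: pos_le_divide_eq)

  have s2: "s\<^sup>2 = (1 - \<alpha>) * (5 - \<alpha>)" and s0: "0 \<le> s"
    using a by (auto simp: s_def)
  have sq: "0 \<le> 2 * \<alpha>\<^sup>2 - 1" "\<alpha>\<^sup>2 \<le> 9 / 16"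
    using b a power_mono[of \<alpha> "3 / 4" 2] by (simp_all add: power2_eq_square)
  have "1 / 2 * \<alpha> \<le> \<alpha>\<^sup>2 * \<alpha>" using sq b by (intro mult_right_mono) auto
  then have cube: "1 / 2 * \<alpha> \<le> \<alpha> ^ 3" by (simp add: power3_eq_cube power2_eq_square)
  \<comment> \<open>Clearing denominators turns the claim into (1 + 2\<alpha>) s \<le> Q.\<close>
  define Q where "Q = 6 - 5 * \<alpha> - 8 * \<alpha>\<^sup>2 + 12 * \<alpha> ^ 3"
  have "(1 + 2 * \<alpha>) * s \<le> Q"
  proof (rule power2_le_imp_le)
    show "0 \<le> Q" unfolding Q_def using sq cube a b by linarith
    have "((1 + 2 * \<alpha>) * s)\<^sup>2 = (1 + 2 * \<alpha>)\<^sup>2 * ((1 - \<alpha>) * (5 - \<alpha>))"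
      by (simp only: power_mult_distrib s2)
    also have "\<dots> = Q\<^sup>2 - (2 * \<alpha>\<^sup>2 - 1) * ((2 * \<alpha> - 1) * (36 * \<alpha> ^ 3 - 30 * \<alpha>\<^sup>2 - 12 * \<alpha> + 31))"
      unfolding Q_def by algebra
    also have "\<dots> \<le> Q\<^sup>2"
    proof -
      have "0 \<le> 36 * \<alpha> ^ 3 - 30 * \<alpha>\<^sup>2 - 12 * \<alpha> + 31" using sq cube a b by linarith
      then show ?thesis using sq b by simp
    qed
    finally show "((1 + 2 * \<alpha>) * s)\<^sup>2 \<le> Q\<^sup>2" .
  qed
  then have "(1 + \<alpha>) * (5 * (2 * \<alpha> - 1)) \<le> (1 - 2 * \<alpha> + 6 * \<alpha>\<^sup>2 - s) * (1 + 2 * \<alpha>)"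
    by (simp add: Q_def power2_eq_square power3_eq_cube algebra_simps)
  then show "1 + \<alpha> \<le> alpha_hat \<alpha> * (1 + 2 * \<alpha>)"
    unfolding ah times_divide_eq_left using pos by (simp add: pos_le_divide_eq)

  \<comment> \<open>\<open>A\<close> is the value of \<open>s\<close> at which
    \<open>alpha_hat \<alpha>\<close> would equal \<alpha>; s^2 exceeds A^2 by 4(1 -
    \<alpha>)(2\<alpha> - 1)(2\<alpha>^2 - 1), which is of order eta.\<close>
  define A where "A = (1 - \<alpha>) * (1 + 4 * \<alpha>)"
  have A: "0 \<le> A" "A \<le> 1172 / 1000"
  proof -
    show "0 \<le> A" unfolding A_def using a b by simp
    have "A \<le> 293 / 1000 * 4"
      unfolding A_def using a b by (intro mult_mono) auto
    then show "A \<le> 1172 / 1000" by simp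
  qed
  let ?e = "eta \<alpha>"
  \<comment> \<open>Clearing denominators multiplies the margin eta/25 by 5(2\<alpha> - 1)\<alpha>
    \<le> 15/8, and 15/8/25 = 3/40.\<close>
  have "A + 3 / 40 * ?e \<le> s"
    unfolding s_def
  proof (rule real_le_rsqrt)
    have "?e * ?e \<le> 43 / 1000 * ?e" "A * ?e \<le> 1172 / 1000 * ?e"
      using b A by (auto intro!: mult_right_mono simp del: mult_le_cancel_right_pos)
    moreover have "(A + 3 / 40 * ?e)\<^sup>2 = A\<^sup>2 + 3 / 20 * (A * ?e) + 9 / 1600 * (?e * ?e)"
      by (simp add: power2_eq_square field_simps)
    ultimately have "(A + 3 / 40 * ?e)\<^sup>2 \<le> A\<^sup>2 + 2 / 10 * ?e"
      using b by linarith
    also have "2 / 10 * ?e \<le> 4 * ((1 / 4 * (414 / 1000)) * (14 / 5 * ?e))"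
      using b by simp
    also have "\<dots> \<le> 4 * (((1 - \<alpha>) * (2 * \<alpha> - 1)) * (2 * \<alpha>\<^sup>2 - 1))"
      using a b by (intro mult_mono mult_left_mono) auto
    also have "A\<^sup>2 + \<dots> = (1 - \<alpha>) * (5 - \<alpha>)"
      by (simp add: A_def power2_eq_square algebra_simps)
    finally show "(A + 3 / 40 * ?e)\<^sup>2 \<le> (1 - \<alpha>) * (5 - \<alpha>)" by simp
  qed
  moreover have "5 * (2 * \<alpha> - 1) * \<alpha> * (?e / 25) \<le> 5 * (1 / 2) * (3 / 4) * (?e / 25)"
    using a b by (intro mult_mono) auto
  ultimately have "1 - 2 * \<alpha> + 6 * \<alpha>\<^sup>2 - s \<le> (1 - ?e / 25) * \<alpha> * (5 * (2 * \<alpha> - 1))"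
    by (simp add: A_def power2_eq_square algebra_simps)
  then show "alpha_hat \<alpha> \<le> (1 - ?e / 25) * \<alpha>"
    unfolding ah using pos by (simp add: pos_divide_le_eq)
qed

lemma script_B_root:
  assumes "0 < \<alpha>" shows "0 < script_B \<alpha>" "script_B \<alpha> * (1 + script_B \<alpha>) = \<alpha>"
proof -
  have "1 < sqrt (1 + 4 * \<alpha>)" using assms by simp
  then show "0 < script_B \<alpha>" by (simp add: script_B_def)
  have "(sqrt (1 + 4 * \<alpha>))\<^sup>2 = 1 + 4 * \<alpha>" using assms by simp
  then show "script_B \<alpha> * (1 + script_B \<alpha>) = \<alpha>"
    by (simp add: script_B_def power2_eq_square field_simps)
qed

lemma ok_bound_above_B:
  assumes "0 < \<alpha>" "script_B \<alpha> \<le> y" "y \<le> \<alpha>\<^sup>2" shows "ok_bound \<alpha> y"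
proof -
  have "script_B \<alpha> * (1 + script_B \<alpha>) \<le> y * (1 + y)"
    using assms script_B_root[of \<alpha>] by (intro mult_mono) auto
  with assms script_B_root[of \<alpha>] show ?thesis by (simp add: ok_bound_def)
qed

text \<open>With q = 1 - \<alpha>^2 + \<beta>, \<open>beta_hat\<close> is \<alpha> times the smaller
  root of q x^2 - (1 + \<alpha>) x + \<alpha>. This quadratic is nonnegative at w =
  \<open>script_B \<alpha> / \<alpha>\<close>, which lies left of the vertex, and nonpositive at
  \<alpha> because q \<le> 1; so the root lies between w and \<alpha>.\<close>

lemma beta_hat_bounds:
  assumes \<alpha>: "707 / 1000 < \<alpha>" "\<alpha> < 3 / 4" and \<beta>: "script_B \<alpha> < \<beta>" "\<beta> \<le> \<alpha>\<^sup>2"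
  shows "script_B \<alpha> \<le> beta_hat \<alpha> \<beta>" "beta_hat \<alpha> \<beta> \<le> \<alpha>\<^sup>2"
proof -
  define q where "q = 1 - \<alpha>\<^sup>2 + \<beta>"
  define r where "r = sqrt ((1 - \<alpha>)\<^sup>2 + 4 * \<alpha> * (\<alpha>\<^sup>2 - \<beta>))"
  define w where "w = script_B \<alpha> / \<alpha>"
  have B: "0 < script_B \<alpha>" "script_B \<alpha> * (1 + script_B \<alpha>) = \<alpha>"
    using script_B_root \<alpha> by auto
  have Bw: "script_B \<alpha> = \<alpha> * w" using \<alpha> by (simp add: w_def)
  have w: "0 < w" using B \<alpha> by (simp add: w_def)
  have "\<alpha> * (w * (1 + \<alpha> * w)) = \<alpha> * 1" using B(2) by (simp add: Bw algebra_simps)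
  then have w1: "w * (1 + \<alpha> * w) = 1" using \<alpha> by (subst (asm) mult_left_cancel) auto
  have "\<alpha>\<^sup>2 < 1" using \<alpha> by (simp add: power_less_one_iff)
  have q: "0 < q" "q \<le> 1" "1 - \<alpha>\<^sup>2 + \<alpha> * w \<le> q"
    using \<beta> B(1) \<open>\<alpha>\<^sup>2 < 1\<close> by (auto simp: q_def Bw)
  have rq: "(1 - \<alpha>)\<^sup>2 + 4 * \<alpha> * (\<alpha>\<^sup>2 - \<beta>) = (1 + \<alpha>)\<^sup>2 - 4 * \<alpha> * q"
    by (simp add: q_def power2_eq_square algebra_simps)
  have bh: "beta_hat \<alpha> \<beta> = (1 + \<alpha> - r) / (2 * q) * \<alpha>"
    by (simp add: beta_hat_def q_def r_def)

  have "w \<le> 7 / 10"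
  proof (rule ccontr)
    assume "\<not> ?thesis"
    then have "7 / 10 * (1 + 7 / 10 * (7 / 10)) \<le> w * (1 + \<alpha> * w)"
      using \<alpha> by (intro mult_mono add_mono) auto
    with w1 show False by simp
  qed
  then have "q * w \<le> 1 * (7 / 10)" using q w by (intro mult_mono) auto
  have "r \<le> 1 + \<alpha> - 2 * q * w"
    unfolding r_def rq
  proof (rule real_le_lsqrt)
    show "0 \<le> 1 + \<alpha> - 2 * q * w" using \<open>q * w \<le> 1 * (7 / 10)\<close> \<alpha> by simp
    have "(1 - \<alpha>\<^sup>2 + \<alpha> * w) * w\<^sup>2 \<le> q * w\<^sup>2" using q by (intro mult_right_mono) auto
    \<comment> \<open>The right-hand side vanishes by \<open>w1\<close>: w is a root of the
      quadratic in the limiting case \<beta> = \<open>script_B \<alpha>\<close>.\<close>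
    moreover have "(1 - \<alpha>\<^sup>2 + \<alpha> * w) * w\<^sup>2 - (w * (1 + \<alpha>) - \<alpha>) =
        (w - \<alpha>) * (w * (1 + \<alpha> * w) - 1)"
      by (simp add: power2_eq_square algebra_simps)
    ultimately have "w * (1 + \<alpha>) - \<alpha> \<le> q * w\<^sup>2" using w1 by simp
    then have "4 * q * (w * (1 + \<alpha>) - \<alpha>) \<le> 4 * q * (q * w\<^sup>2)"
      using q by (intro mult_left_mono) auto
    then show "(1 + \<alpha>)\<^sup>2 - 4 * \<alpha> * q \<le> (1 + \<alpha> - 2 * q * w)\<^sup>2"
      by (simp add: power2_eq_square algebra_simps)
  qed
  then have "w * (2 * q) \<le> 1 + \<alpha> - r" by (simp add: mult_ac)
  then have "w \<le> (1 + \<alpha> - r) / (2 * q)" using q by (simp add: pos_le_divide_eq)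
  then have "w * \<alpha> \<le> (1 + \<alpha> - r) / (2 * q) * \<alpha>" using \<alpha> by (intro mult_right_mono) auto
  then show "script_B \<alpha> \<le> beta_hat \<alpha> \<beta>" by (simp add: bh Bw mult.commute)

  have "1 + \<alpha> - 2 * q * \<alpha> \<le> r"
    unfolding r_def rq
  proof (rule real_le_rsqrt)
    have "4 * q * \<alpha> * (\<alpha> * q) \<le> 4 * q * \<alpha> * (\<alpha> * 1)"
      using q \<alpha> by (intro mult_left_mono) auto
    then show "(1 + \<alpha> - 2 * q * \<alpha>)\<^sup>2 \<le> (1 + \<alpha>)\<^sup>2 - 4 * \<alpha> * q"
      by (simp add: power2_eq_square algebra_simps)
  qed
  then have "(1 + \<alpha> - r) / (2 * q) \<le> \<alpha>" using q by (simp add: pos_divide_le_eq mult_ac)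
  then have "(1 + \<alpha> - r) / (2 * q) * \<alpha> \<le> \<alpha> * \<alpha>" using \<alpha> by (intro mult_right_mono) auto
  then show "beta_hat \<alpha> \<beta> \<le> \<alpha>\<^sup>2" by (simp add: bh power2_eq_square)
qed

section \<open>Instantiation of the parameters and the total count\<close>

lemma gcb_algorithm:
  assumes \<alpha>: "1 / sqrt 2 < \<alpha>" "\<alpha> < 3 / 4" and \<beta>: "script_B \<alpha> < \<beta>" "\<beta> \<le> \<alpha>\<^sup>2"
  shows "gcb_algorithm \<alpha> (eta \<alpha> / 25) \<beta>"
proof -
  note b = eta_alpha_bounds[OF \<alpha>]
  have "ok_bound \<alpha> \<beta>" "ok_bound \<alpha> (beta_hat \<alpha> \<beta>)"
    using b \<beta> beta_hat_bounds[OF b(3) \<alpha>(2) \<beta>] by (auto intro!: ok_bound_above_B)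
  with \<alpha> b alpha_hat_bounds[OF \<alpha>] show ?thesis
    by unfold_locales auto
qed

theorem theorem5:
  fixes c :: nat
  shows "\<exists>K::real. \<forall>(\<alpha>::real) (\<beta>::real) (k::nat) (T :: nat \<Rightarrow> 'a::linorder tree) (m :: nat \<Rightarrow> nat).
    1 / sqrt 2 < \<alpha> \<longrightarrow> \<alpha> < 3 / 4 \<longrightarrow> script_B \<alpha> < \<beta> \<longrightarrow> \<beta> \<le> \<alpha>\<^sup>2 \<longrightarrow>
    T 0 = \<langle>\<rangle> \<longrightarrow>
    (\<forall>l\<le>k. GCB \<alpha> \<beta> (T l)) \<longrightarrow>
    (\<forall>l<k. update_step \<alpha> \<beta> c (T l) (T (Suc l)) (m l)) \<longrightarrow>
    real (\<Sum>l<k. m l) \<le> K * (real k / eta \<alpha> + real k / eps \<alpha> \<beta>)"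
proof (intro exI allI impI)
  fix \<alpha> \<beta> :: real and k :: nat and T :: "nat \<Rightarrow> 'a tree" and m :: "nat \<Rightarrow> nat"
  assume \<alpha>: "1 / sqrt 2 < \<alpha>" "\<alpha> < 3 / 4" and \<beta>: "script_B \<alpha> < \<beta>" "\<beta> \<le> \<alpha>\<^sup>2"
    and T0: "T 0 = \<langle>\<rangle>" and T: "\<forall>l\<le>k. GCB \<alpha> \<beta> (T l)"
    and step: "\<forall>l<k. update_step \<alpha> \<beta> c (T l) (T (Suc l)) (m l)"
  interpret gcb_algorithm \<alpha> "eta \<alpha> / 25" \<beta> c by (rule gcb_algorithm[OF \<alpha> \<beta>])
  have "eta \<alpha> / 25 / 18 * real (\<Sum>l<k. m l) \<le> real k * (1000 + real c)"
  proof (rule total_rotations[of T k m])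
    show "cbal \<alpha> (T l)" if "l < k" for l
      using T that by (intro GCB_imp_cbal[of \<alpha> \<beta>]) auto
  qed (use T0 step in auto)
  \<comment> \<open>450 = 25 * 18: a gain of eta/25 is shared by at most 18 rotations.\<close>
  then have "real (\<Sum>l<k. m l) \<le> 450 * (1000 + real c) * (real k / eta \<alpha>)"
    using eta_alpha_bounds(1)[OF \<alpha>] by (simp add: field_simps)
  also have "0 < eps \<alpha> \<beta>" using \<beta> by (simp add: eps_def)
  then have "450 * (1000 + real c) * (real k / eta \<alpha>)
      \<le> 450 * (1000 + real c) * (real k / eta \<alpha> + real k / eps \<alpha> \<beta>)"
    by (intro mult_left_mono) auto
  finally show "real (\<Sum>l<k. m l) \<le> 450 * (1000 + real c) * (real k / eta \<alpha> + real k / eps \<alpha> \<beta>)" .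
qed

end
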